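(* Let $\mathcal{H}_3$ be the class of $2$-vertex $n$-extremal minimal bipartite matching covered graphs and $\mathcal{H}_4$ the class of edge extremal minimal bipartite matching covered graphs. Then $\mathcal{H}_4\cap\mathcal{H}_3=\{\Theta\}$ (up to isomorphism).
   Context: All graphs are finite and loopless; parallel edges are allowed. For a graph $G=(V,E)$ write $n=|V|$. A connected graph on four or more vertices is matching covered if every edge lies in some perfect matching. A matching covered graph is minimal if deleting any single edge yields a graph that is not matching covered. $V_2$ is the set of vertices of degree two. A minimal bipartite matching covered graph is $2$-vertex $n$-extremal if $|V_2|=\frac n2+2$, and edge extremal if $|E|=\frac{3n-6}{2}$. $\Theta$ is the graph on $8$ vertices and $9$ edges consisting of two vertices joined by three internally disjoint paths, each of length three. *)

theory Defs
  imports Complex_Main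
begin

text \<open>Undirected multigraphs: edges are abstract objects, each with a set of ends, so that
  parallel edges are distinct edges with the same ends.\<close>

record ('v, 'e) multigraph =
  verts :: "'v set"
  edges :: "'e set"
  ends :: "'e \<Rightarrow> 'v set"

text \<open>Finite and loopless: every edge has exactly two ends.\<close>

definition wf_multigraph :: "('v, 'e) multigraph \<Rightarrow> bool" where
  "wf_multigraph G \<longleftrightarrow> finite (verts G) \<and> finite (edges G) \<and>
     (\<forall>e\<in>edges G. ends G e \<subseteq> verts G \<and> card (ends G e) = 2)"

definition degree :: "('v, 'e) multigraph \<Rightarrow> 'v \<Rightarrow> nat" where
  "degree G v = card {e \<in> edges G. v \<in> ends G e}"

definition adjacency :: "('v, 'e) multigraph \<Rightarrow> ('v \<times> 'v) set" where
  "adjacency G = {(u, v). \<exists>e\<in>edges G. ends G e = {u, v}}"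

definition connected_graph :: "('v, 'e) multigraph \<Rightarrow> bool" where
  "connected_graph G \<longleftrightarrow> verts G \<noteq> {} \<and>
     (\<forall>u\<in>verts G. \<forall>v\<in>verts G. (u, v) \<in> (adjacency G)\<^sup>*)"

definition bipartite :: "('v, 'e) multigraph \<Rightarrow> bool" where
  "bipartite G \<longleftrightarrow> (\<exists>A B. A \<union> B = verts G \<and> A \<inter> B = {} \<and>
     (\<forall>e\<in>edges G. \<exists>a\<in>A. \<exists>b\<in>B. ends G e = {a, b}))"

definition perfect_matching :: "('v, 'e) multigraph \<Rightarrow> 'e set \<Rightarrow> bool" where
  "perfect_matching G M \<longleftrightarrow> M \<subseteq> edges G \<and> (\<forall>v\<in>verts G. \<exists>!e. e \<in> M \<and> v \<in> ends G e)"

definition matching_covered :: "('v, 'e) multigraph \<Rightarrow> bool" where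
  "matching_covered G \<longleftrightarrow> wf_multigraph G \<and> connected_graph G \<and> 4 \<le> card (verts G) \<and>
     (\<forall>e\<in>edges G. \<exists>M. perfect_matching G M \<and> e \<in> M)"

definition delete_edge :: "('v, 'e) multigraph \<Rightarrow> 'e \<Rightarrow> ('v, 'e) multigraph" where
  "delete_edge G e = G\<lparr>edges := edges G - {e}\<rparr>"

definition minimal_matching_covered :: "('v, 'e) multigraph \<Rightarrow> bool" where
  "minimal_matching_covered G \<longleftrightarrow> matching_covered G \<and>
     (\<forall>e\<in>edges G. \<not> matching_covered (delete_edge G e))"

definition V2 :: "('v, 'e) multigraph \<Rightarrow> 'v set" where
  "V2 G = {v \<in> verts G. degree G v = 2}"

definition two_vertex_n_extremal :: "('v, 'e) multigraph \<Rightarrow> bool" where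
  "two_vertex_n_extremal G \<longleftrightarrow> real (card (V2 G)) = real (card (verts G)) / 2 + 2"

definition edge_extremal :: "('v, 'e) multigraph \<Rightarrow> bool" where
  "edge_extremal G \<longleftrightarrow> real (card (edges G)) = (3 * real (card (verts G)) - 6) / 2"

definition H3 :: "('v, 'e) multigraph set" where
  "H3 = {G. bipartite G \<and> minimal_matching_covered G \<and> two_vertex_n_extremal G}"

definition H4 :: "('v, 'e) multigraph set" where
  "H4 = {G. bipartite G \<and> minimal_matching_covered G \<and> edge_extremal G}"

definition isomorphic :: "('v, 'e) multigraph \<Rightarrow> ('w, 'f) multigraph \<Rightarrow> bool" where
  "isomorphic G H \<longleftrightarrow> (\<exists>f g. bij_betw f (verts G) (verts H) \<and> bij_betw g (edges G) (edges H) \<and>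
     (\<forall>e\<in>edges G. ends H (g e) = f ` ends G e))"

text \<open>The vertices 0 and 7 are joined by the paths 0-1-2-7, 0-3-4-7 and 0-5-6-7; the graph is
  simple, so each edge is taken to be its own set of ends.\<close>

definition Theta :: "(nat, nat set) multigraph" where
  "Theta = \<lparr>verts = {0..7},
            edges = {{0, 1}, {1, 2}, {2, 7},
                     {0, 3}, {3, 4}, {4, 7},
                     {0, 5}, {5, 6}, {6, 7}},
            ends = (\<lambda>e. e)\<rparr>"

end

theory Submission
  imports Defs "HOL-Combinatorics.Permutations"
begin

text \<open>Contracting a perfect matching \<open>M\<close> of a bipartite graph and directing the remaining edges
  from one colour class to the other gives a digraph that is strong iff the graph is matching covered;
  if the graph is minimal, no arc of any of these digraphs can be bypassed. On more than four
  vertices there are no directed 2-cycles: exchanging \<open>M\<close> along the corresponding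
  4-cycle would otherwise produce an arc that can be bypassed.

  If the graph has \<open>2N\<close> vertices and is edge extremal, the digraph has \<open>N\<close> vertices and
  \<open>2N - 3\<close> arcs. Adding ears to a strong subdigraph, an ear with \<open>k\<close> inner vertices contributes
  \<open>k + 1 \<le> 2k\<close> arcs, so the count forces every cycle to be a triangle and every ear of a triangle
  to have one inner vertex. All these ears are antiparallel to the same arc, hence the graph consists
  of two vertices joined by \<open>k\<close> disjoint paths of length three. It has \<open>n = 2k + 2\<close> vertices,
  of which \<open>2k\<close> have degree two if \<open>k \<ge> 3\<close> (and all six if \<open>k = 2\<close>), so being
  2-vertex extremal means \<open>k = 3\<close>.\<close>

section \<open>Irredundant strong digraphs\<close>

abbreviation walk :: "('a \<times> 'a) set \<Rightarrow> 'a list \<Rightarrow> bool" where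
  "walk R xs \<equiv> xs \<noteq> [] \<and> successively (\<lambda>x y. (x, y) \<in> R) xs"

text \<open>The walk is built from its end; whenever the new start already lies on it, the loop is
  cut off. Distinctness is what lets such walks serve as ears and as cycles.\<close>

lemma rtrancl_distinct_walk:
  assumes "(a, b) \<in> R\<^sup>*"
  obtains xs where "walk R xs" "distinct xs" "hd xs = a" "last xs = b"
proof -
  have "\<exists>xs. walk R xs \<and> distinct xs \<and> hd xs = a \<and> last xs = b"
    using assms
  proof (induction rule: converse_rtrancl_induct)
    case base
    then show ?case by (intro exI[of _ "[b]"]) simp
  next
    case (step a c)
    then obtain xs where xs: "walk R xs" "distinct xs" "hd xs = c" "last xs = b" by blast
    show ?case
    proof (cases "a \<in> set xs")
      case True
      then obtain ys zs where "xs = ys @ a # zs" by (meson split_list)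
      with xs show ?thesis
        by (intro exI[of _ "a # zs"]) (auto simp: successively_append_iff)
    next
      case False
      with xs step.hyps show ?thesis
        by (intro exI[of _ "a # xs"]) (auto simp: successively_Cons)
    qed
  qed
  then show thesis using that by blast
qed

lemma walk_imp_rtrancl:
  assumes "walk R xs" "x \<in> set xs"
  shows "(hd xs, x) \<in> R\<^sup>*" "(x, last xs) \<in> R\<^sup>*"
proof -
  have "(hd xs, x) \<in> R\<^sup>* \<and> (x, last xs) \<in> R\<^sup>*"
    using assms
  proof (induction xs arbitrary: x)
    case Nil
    then show ?case by simp
  next
    case (Cons a xs)
    show ?case
    proof (cases "xs = []")
      case True
      then show ?thesis using Cons.prems by simp
    next
      case False
      then have w: "walk R xs" and a: "(a, hd xs) \<in> R"
        using Cons.prems by (auto simp: successively_Cons)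
      have "(a, y) \<in> R\<^sup>*" if "y \<in> set xs" for y
        using Cons.IH[OF w that] a by (meson converse_rtrancl_into_rtrancl)
      moreover have "last xs \<in> set xs" using False by simp
      ultimately show ?thesis using Cons.prems(2) False Cons.IH[OF w]
        by auto
    qed
  qed
  then show "(hd xs, x) \<in> R\<^sup>*" "(x, last xs) \<in> R\<^sup>*" by auto
qed

text \<open>Every vertex moves to its successor and the last one back to the first. If an arc closes
  the walk to a directed cycle, composing a matching map with \<open>\<sigma>\<close> exchanges the
  matching along this cycle.\<close>

lemma distinct_walk_cyclic_permutation:
  assumes "walk R xs" "distinct xs"
  obtains \<sigma> where "\<sigma> permutes set xs" "\<sigma> (last xs) = hd xs"
    "\<And>x. x \<in> set xs \<Longrightarrow> x \<noteq> last xs \<Longrightarrow> (x, \<sigma> x) \<in> R"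
proof -
  have "\<exists>\<sigma>. \<sigma> permutes set xs \<and> \<sigma> (last xs) = hd xs \<and>
    (\<forall>x\<in>set xs. x \<noteq> last xs \<longrightarrow> (x, \<sigma> x) \<in> R)"
    using assms
  proof (induction xs)
    case Nil
    then show ?case by simp
  next
    case (Cons a xs)
    show ?case
    proof (cases "xs = []")
      case True
      then show ?thesis by (intro exI[of _ id]) (simp add: permutes_id id_def)
    next
      case False
      define y where "y = hd xs"
      have y: "y \<in> set xs" using False by (simp add: y_def)
      have a: "a \<notin> set xs" "(a, y) \<in> R" "walk R xs" "distinct xs"
        using Cons.prems False by (auto simp: successively_Cons y_def)
      then obtain \<sigma> where \<sigma>: "\<sigma> permutes set xs" "\<sigma> (last xs) = y"
        "\<And>x. x \<in> set xs \<Longrightarrow> x \<noteq> last xs \<Longrightarrow> (x, \<sigma> x) \<in> R"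
        using Cons.IH y_def by blast
      \<comment> \<open>The transposition redirects the image of \<open>last xs\<close> from
        \<open>y\<close> to \<open>a\<close>, and sends \<open>a\<close>, a fixed point of
        \<open>\<sigma>\<close>, to \<open>y\<close>.\<close>
      define \<tau> where "\<tau> = transpose a y \<circ> \<sigma>"
      have "\<tau> permutes set (a # xs)"
        unfolding \<tau>_def
        by (intro permutes_compose[OF permutes_subset[OF \<sigma>(1)]] permutes_swap_id) (use y in auto)
      moreover have "\<tau> (last (a # xs)) = a" using False \<sigma>(2) by (simp add: \<tau>_def)
      moreover have "\<tau> a = y" using \<sigma>(1) a(1) by (simp add: \<tau>_def permutes_not_in)
      moreover have "\<tau> x = \<sigma> x" if x: "x \<in> set xs" "x \<noteq> last xs" for x
      proof -
        have "\<sigma> x \<in> set xs" using x \<sigma>(1) by (simp add: permutes_in_image)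
        moreover have "\<sigma> x \<noteq> y" using x \<sigma>(1,2) by (metis permutes_inj injD)
        ultimately show ?thesis using a(1) by (metis \<tau>_def comp_apply transpose_apply_other)
      qed
      ultimately show ?thesis using \<sigma>(3) a(2) False by (intro exI[of _ \<tau>]) auto
    qed
  qed
  then show thesis using that by blast
qed

text \<open>Stops a path at its first entry into \<open>S\<close>; the part before lies outside
  \<open>S\<close> and can become the interior of an ear.\<close>

lemma rtrancl_enters_set:
  assumes "(v, t) \<in> R\<^sup>*" "v \<notin> S" "t \<in> S"
  obtains u t' where "(v, u) \<in> (R \<inter> (- S) \<times> (- S))\<^sup>*" "u \<notin> S" "(u, t') \<in> R" "t' \<in> S"
proof -
  have "\<exists>u t'. (v, u) \<in> (R \<inter> (- S) \<times> (- S))\<^sup>* \<and> u \<notin> S \<and> (u, t') \<in> R \<and> t' \<in> S"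
    using assms
  proof (induction rule: converse_rtrancl_induct)
    case base
    then show ?case by simp
  next
    case (step v w)
    show ?case
    proof (cases "w \<in> S")
      case True
      with step show ?thesis by blast
    next
      case False
      with step have "(v, w) \<in> R \<inter> (- S) \<times> (- S)" by simp
      with step False show ?thesis by (meson converse_rtrancl_into_rtrancl)
    qed
  qed
  then show thesis using that by blast
qed

lemma rtrancl_leaves_set:
  assumes "(s, v) \<in> R\<^sup>*" "s \<in> S" "v \<notin> S"
  obtains s' v' where "(s', v') \<in> R" "s' \<in> S" "v' \<notin> S"
  using assms by (induction arbitrary: thesis rule: converse_rtrancl_induct) metis+

text \<open>Since the closure is reflexive, an irredundant digraph has no loops.\<close>

definition irredundant :: "('a \<times> 'a) set \<Rightarrow> bool" where
  "irredundant R \<longleftrightarrow> (\<forall>(a, b)\<in>R. (a, b) \<notin> (R - {(a, b)})\<^sup>*)"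

definition strong :: "'a set \<Rightarrow> ('a \<times> 'a) set \<Rightarrow> bool" where
  "strong V R \<longleftrightarrow> (\<forall>u\<in>V. \<forall>v\<in>V. (u, v) \<in> R\<^sup>*)"

lemma irredundant_bypass:
  assumes "(a, b) \<in> Q\<^sup>*" "(a, b) \<notin> Q" "Q \<subseteq> R" "irredundant R" "(a, b) \<in> R"
  shows False
proof -
  have "Q \<subseteq> R - {(a, b)}" using assms by blast
  then have "(a, b) \<in> (R - {(a, b)})\<^sup>*" using assms(1) rtrancl_mono by blast
  with assms(4,5) show False unfolding irredundant_def by blast
qed

text \<open>Any further arc of \<open>R\<close> inside \<open>S\<close> would be bypassed by a path
  in \<open>Q\<close>. This is what makes exact arc counts possible.\<close>

lemma irredundant_strong_subset:
  assumes "irredundant R" "Q \<subseteq> R \<inter> S \<times> S" "strong S Q"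
  shows "R \<inter> S \<times> S = Q"
proof (rule antisym)
  show "R \<inter> S \<times> S \<subseteq> Q"
  proof clarify
    fix a b
    assume "(a, b) \<in> R" "a \<in> S" "b \<in> S"
    then show "(a, b) \<in> Q"
      using assms irredundant_bypass[of a b Q R] unfolding strong_def by blast
  qed
qed (use assms in blast)

text \<open>\<open>set (zip xs (tl xs))\<close> is the arc set of the walk, in a form whose
  cardinality is easy to compute.\<close>

lemma set_zip_tl_walk:
  "set (zip xs (tl xs)) \<subseteq> R \<longleftrightarrow> successively (\<lambda>x y. (x, y) \<in> R) xs"
proof (induction xs)
  case (Cons a xs)
  then show ?case by (cases xs) auto
qed simp

section \<open>Counting arcs along ears, for N vertices and 2N - 3 arcs\<close>

locale extremal_digraph =
  fixes V :: "'a set" and R :: "('a \<times> 'a) set"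
  assumes finV: "finite V" and RV: "R \<subseteq> V \<times> V" and strongV: "strong V R"
    and irr: "irredundant R" and no2: "\<And>a b. (a, b) \<in> R \<Longrightarrow> (b, a) \<notin> R"
    and cardR: "card R + 3 = 2 * card V"
begin

abbreviation arcs :: "'a set \<Rightarrow> ('a \<times> 'a) set" where "arcs S \<equiv> R \<inter> S \<times> S"

definition good :: "'a set \<Rightarrow> bool" where
  "good S \<longleftrightarrow> S \<noteq> {} \<and> S \<subseteq> V \<and> strong S (arcs S)"

text \<open>\<open>xs\<close> lists only the inner vertices and is nonempty by the definition of
  \<open>walk\<close>. The ends \<open>s\<close> and \<open>t\<close> may coincide, so a directed
  cycle of length at least two is an ear of a singleton.\<close>

definition ear :: "'a set \<Rightarrow> 'a \<Rightarrow> 'a list \<Rightarrow> 'a \<Rightarrow> bool" where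
  "ear S s xs t \<longleftrightarrow> s \<in> S \<and> t \<in> S \<and> walk R xs \<and> distinct xs \<and> set xs \<inter> S = {} \<and>
     (s, hd xs) \<in> R \<and> (last xs, t) \<in> R"

lemma finite_R: "finite R"
  using finV RV by (meson finite_SigmaI finite_subset)

text \<open>The arcs of \<open>S\<close> and of the ear already form a strong digraph
  \<open>Q\<close>, as every vertex reaches \<open>s\<close> and is reached from it. By irredundance
  no other arcs occur, so k inner vertices bring exactly k - 1 inner arcs and two end arcs.\<close>

lemma good_ear:
  assumes S: "good S" and e: "ear S s xs t"
  shows "good (S \<union> set xs)"
    and "arcs (S \<union> set xs) = arcs S \<union> {(s, hd xs), (last xs, t)} \<union> set (zip xs (tl xs))"
    and "card (arcs (S \<union> set xs)) = card (arcs S) + length xs + 1"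
proof -
  let ?S = "S \<union> set xs"
  let ?Z = "set (zip xs (tl xs))"
  define Q where "Q = arcs S \<union> {(s, hd xs), (last xs, t)} \<union> ?Z"
  note e' = e[unfolded ear_def]
  have st: "s \<in> S" "t \<in> S" and xs: "walk R xs" "distinct xs" "set xs \<inter> S = {}" "xs \<noteq> []"
    and sh: "(s, hd xs) \<in> R" "(last xs, t) \<in> R" using e' by auto
  have hl: "hd xs \<in> set xs" "last xs \<in> set xs" using xs by auto
  have ZR: "?Z \<subseteq> R" using xs set_zip_tl_walk by blast
  have Zx: "?Z \<subseteq> set xs \<times> set xs"
    using xs(4) by (auto dest: set_zip_leftD set_zip_rightD list.set_sel(2))
  have xV: "set xs \<subseteq> V"
  proof
    fix x assume x: "x \<in> set xs"
    have "(s, x) \<in> R\<^sup>+"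
      using walk_imp_rtrancl(1)[OF xs(1) x] sh(1) by (meson rtrancl_into_trancl2)
    then show "x \<in> V" using RV by (metis SigmaD2 subsetD tranclD2)
  qed
  have QR: "Q \<subseteq> R" unfolding Q_def using ZR sh by blast
  have QS: "Q \<subseteq> arcs ?S" using QR Zx hl st unfolding Q_def by auto
  have wQ: "walk Q xs" using xs(4) set_zip_tl_walk[of xs Q] unfolding Q_def by auto
  have SQ: "(u, v) \<in> Q\<^sup>*" if "u \<in> S" "v \<in> S" for u v
  proof -
    have "(u, v) \<in> (arcs S)\<^sup>*" using S that unfolding good_def strong_def by blast
    then show ?thesis using rtrancl_mono[of "arcs S" Q] unfolding Q_def by blast
  qed
  have "(s, v) \<in> Q\<^sup>* \<and> (v, s) \<in> Q\<^sup>*" if "v \<in> ?S" for v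
  proof (cases "v \<in> S")
    case True
    then show ?thesis using SQ st by blast
  next
    case False
    then have v: "v \<in> set xs" using that by simp
    have 1: "(s, hd xs) \<in> Q" "(last xs, t) \<in> Q" unfolding Q_def by auto
    from walk_imp_rtrancl[OF wQ v] 1 SQ[OF st(2,1)] show ?thesis
      by (meson converse_rtrancl_into_rtrancl rtrancl_into_rtrancl rtrancl_trans)
  qed
  then have str: "strong ?S Q" unfolding strong_def by (meson rtrancl_trans)
  have eq: "arcs ?S = Q" by (rule irredundant_strong_subset[OF irr QS str])
  then show "arcs ?S = arcs S \<union> {(s, hd xs), (last xs, t)} \<union> ?Z" by (simp add: Q_def)
  show "good ?S" using S xV str eq unfolding good_def by auto
  have "card ?Z = length xs - 1"
    using distinct_card[OF distinct_zipI1[OF xs(2)], of "tl xs"] by simp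
  moreover have "(s, hd xs) \<noteq> (last xs, t)" using st hl xs(3) by blast
  then have "card {(s, hd xs), (last xs, t)} = 2" by simp
  moreover
  have "card Q = card (arcs S) + card {(s, hd xs), (last xs, t)} + card ?Z"
    unfolding Q_def
    using st hl xs(3) Zx finite_R by (subst card_Un_disjoint; (subst card_Un_disjoint)?) auto
  ultimately show "card (arcs ?S) = card (arcs S) + length xs + 1"
    using eq xs(4) by (cases xs) auto
qed

text \<open>Strength leads from \<open>v\<close> back to \<open>s\<close>; the ear ends where this
  path first enters \<open>S\<close>.\<close>

lemma ear_exists:
  assumes S: "S \<noteq> {}" "S \<subseteq> V" and s: "s \<in> S" "(s, v) \<in> R" "v \<notin> S"
  obtains xs t where "ear S s xs t" "hd xs = v"
proof -
  have "(v, s) \<in> R\<^sup>*" using strongV RV S s unfolding strong_def by blast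
  from rtrancl_enters_set[OF this s(3,1)] obtain u t
    where u: "(v, u) \<in> (R \<inter> (- S) \<times> (- S))\<^sup>*" "u \<notin> S" "(u, t) \<in> R" "t \<in> S" .
  from rtrancl_distinct_walk[OF u(1)] obtain xs
    where xs: "walk (R \<inter> (- S) \<times> (- S)) xs" "distinct xs" "hd xs = v" "last xs = u" .
  have "walk R xs" using xs(1) by (auto elim: successively_mono)
  moreover have "set xs \<inter> S = {}"
  proof -
    have "x \<notin> S" if "x \<in> set xs" for x
      using walk_imp_rtrancl(1)[OF xs(1) that] xs(3) s(3) by (auto elim: rtranclE)
    then show ?thesis by blast
  qed
  ultimately have "ear S s xs t" using s xs u unfolding ear_def by auto
  with xs(3) that show thesis by blast
qed

text \<open>The excess \<open>card (arcs S) + 3 - 2 * card S\<close> changes by 1 - k when an ear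
  with k >= 1 inner vertices is added, so it never increases. Since it is 0 at \<open>V\<close>, it
  is nonnegative for every good set.\<close>

lemma good_arcs_lower_bound:
  assumes "good S"
  shows "2 * card S \<le> card (arcs S) + 3"
  using assms
proof (induction "card V - card S" arbitrary: S rule: less_induct)
  case less
  have SV: "S \<subseteq> V" "S \<noteq> {}" using less.prems unfolding good_def by auto
  show ?case
  proof (cases "S = V")
    case True
    then have "arcs S = R" using RV by blast
    with True cardR show ?thesis by simp
  next
    case False
    then obtain s0 v0 where "s0 \<in> S" "v0 \<in> V" "v0 \<notin> S" using SV by blast
    then have "(s0, v0) \<in> R\<^sup>*" using strongV SV unfolding strong_def by blast
    then obtain s v where "(s, v) \<in> R" "s \<in> S" "v \<notin> S"
      using \<open>s0 \<in> S\<close> \<open>v0 \<notin> S\<close> by (rule rtrancl_leaves_set)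
    then obtain xs t where e: "ear S s xs t" using ear_exists SV by metis
    note g = good_ear[OF less.prems e]
    have x: "distinct xs" "xs \<noteq> []" "set xs \<inter> S = {}" using e unfolding ear_def by auto
    have fS: "finite S" using SV finV finite_subset by blast
    have c: "card (S \<union> set xs) = card S + length xs"
      using x fS by (subst card_Un_disjoint) (auto simp: distinct_card)
    have "card (S \<union> set xs) \<le> card V" using g(1) finV card_mono unfolding good_def by blast
    moreover have "length xs > 0" using x by simp
    ultimately have "card V - card (S \<union> set xs) < card V - card S" using c by linarith
    from less.hyps[OF this g(1)]
    have "2 * card (S \<union> set xs) \<le> card (arcs (S \<union> set xs)) + 3" .
    with c g(3) \<open>length xs > 0\<close> show ?thesis by linarith
  qed
qed

section \<open>Tight sets: triangles and ears with one inner vertex\<close>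

definition tight :: "'a set \<Rightarrow> bool" where
  "tight S \<longleftrightarrow> good S \<and> card (arcs S) + 3 = 2 * card S"

text \<open>Two or more inner vertices would push the enlarged set below the lower bound.\<close>

lemma tight_ear:
  assumes S: "tight S" and e: "ear S s xs t"
  shows "length xs = 1" "tight (S \<union> set xs)"
proof -
  have gS: "good S" using S unfolding tight_def by simp
  note g = good_ear[OF gS e]
  have x: "distinct xs" "xs \<noteq> []" "set xs \<inter> S = {}" using e unfolding ear_def by auto
  have fS: "finite S" using gS finV finite_subset unfolding good_def by blast
  have c: "card (S \<union> set xs) = card S + length xs"
    using x fS by (subst card_Un_disjoint) (auto simp: distinct_card)
  have "length xs > 0" using x by simp
  then show l: "length xs = 1"
    using good_arcs_lower_bound[OF g(1)] c g(3) S unfolding tight_def by linarith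
  then show "tight (S \<union> set xs)" using g c S unfolding tight_def by simp
qed

lemma no_loop: "(a, a) \<notin> R"
  using no2 by blast

text \<open>A singleton exceeds the lower bound by one, so an ear of \<open>{x}\<close> that starts
  with the arc has at most two inner vertices. One inner vertex would give a directed 2-cycle; with
  two, the resulting triangle meets the bound exactly.\<close>

lemma arc_in_triangle:
  assumes "(x, y) \<in> R"
  obtains z where "(y, z) \<in> R" "(z, x) \<in> R" "z \<noteq> x" "z \<noteq> y" "x \<noteq> y" "tight {x, y, z}"
proof -
  have xV: "x \<in> V" "y \<noteq> x" using assms RV no_loop by auto
  have g: "good {x}" unfolding good_def strong_def using xV by auto
  obtain xs t where e: "ear {x} x xs t" and h: "hd xs = y"
    using ear_exists[of "{x}" x y] assms xV by auto
  note g' = good_ear[OF g e]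
  have x: "distinct xs" "xs \<noteq> []" "x \<notin> set xs" and t: "(last xs, x) \<in> R"
    using e unfolding ear_def by auto
  have "arcs {x} = {}" using no_loop by auto
  then have a: "card (arcs ({x} \<union> set xs)) = length xs + 1" using g' by simp
  have c: "card ({x} \<union> set xs) = length xs + 1" using x by (simp add: distinct_card)
  have "length xs \<le> 2" using good_arcs_lower_bound[OF g'(1)] a c by simp
  moreover have "length xs \<noteq> 1"
  proof
    assume "length xs = 1"
    then have "xs = [y]" using h by (cases xs) auto
    with t assms no2 show False by auto
  qed
  moreover have "length xs \<noteq> 0" using x by simp
  ultimately have "length xs = 2" by linarith
  then obtain z where xs: "xs = [y, z]" using h by (cases xs; cases "tl xs") auto
  have "(y, z) \<in> R" "(z, x) \<in> R" using e xs unfolding ear_def by auto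
  moreover have "tight {x, y, z}" using a c g'(1) xs unfolding tight_def by (simp add: insert_commute)
  ultimately show thesis using that x xs xV by auto
qed

lemma tight_out_neighbour:
  assumes S: "tight S" and s: "s \<in> S" "(s, v) \<in> R" "v \<notin> S"
  obtains t where "t \<in> S" "(v, t) \<in> R" "tight (insert v S)"
    "arcs (insert v S) = insert (s, v) (insert (v, t) (arcs S))"
proof -
  have "S \<noteq> {}" "S \<subseteq> V" and g: "good S" using S unfolding tight_def good_def by auto
  then obtain xs t where e: "ear S s xs t" and h: "hd xs = v" using ear_exists s by metis
  from tight_ear[OF S e] have l: "length xs = 1" and t: "tight (S \<union> set xs)" by auto
  have xs: "xs = [v]" using l h by (cases xs) auto
  show thesis
    using that[of t] e t good_ear(2)[OF g e] unfolding xs ear_def by auto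
qed

text \<open>If an arc joined two outer vertices \<open>u\<close>, \<open>w\<close> with
  \<open>u\<close> an out-neighbour of \<open>S\<close>, then \<open>w\<close> would return to the
  tight set \<open>insert u S\<close>, and not to \<open>u\<close> as there are no 2-cycles. So
  \<open>[u, w]\<close> would be an ear of \<open>S\<close> with two inner vertices.\<close>

lemma tight_outside:
  assumes S: "tight S" and v: "v \<in> V" "v \<notin> S"
  shows "\<exists>s\<in>S. (s, v) \<in> R"
    and "\<And>w. (v, w) \<in> R \<Longrightarrow> w \<in> S"
proof -
  have SV: "S \<noteq> {}" "S \<subseteq> V" using S unfolding tight_def good_def by auto
  have step: "w \<in> S" if u: "s \<in> S" "(s, u) \<in> R" "u \<notin> S" and uw: "(u, w) \<in> R" for s u w
  proof (rule ccontr)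
    assume w: "w \<notin> S"
    have t: "tight (insert u S)" using tight_out_neighbour[OF S u] by metis
    have wu: "w \<noteq> u" using uw no_loop by auto
    then have "w \<notin> insert u S" using w by simp
    then obtain t' where t': "t' \<in> insert u S" "(w, t') \<in> R"
      using tight_out_neighbour[OF t _ uw] by blast
    have "t' \<noteq> u" using no2 uw t' by blast
    then have "ear S s [u, w] t'" using t' u w wu uw unfolding ear_def by auto
    then show False using tight_ear(1)[OF S] by fastforce
  qed
  \<comment> \<open>No arc leaves \<open>?N\<close>: out-neighbours of \<open>S\<close> outside
    \<open>S\<close> lead back into \<open>S\<close> by \<open>step\<close>. Strength makes
    \<open>?N\<close> all of \<open>V\<close>.\<close>
  let ?N = "S \<union> {v. \<exists>s\<in>S. (s, v) \<in> R}"
  have "v \<in> ?N"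
  proof (rule ccontr)
    assume n: "v \<notin> ?N"
    obtain s where s: "s \<in> S" using SV by blast
    then have "(s, v) \<in> R\<^sup>*" using strongV SV v unfolding strong_def by blast
    then obtain a b where "(a, b) \<in> R" "a \<in> ?N" "b \<notin> ?N"
      using s n by (blast intro: rtrancl_leaves_set[of s v R ?N])
    then show False using step by blast
  qed
  then show ex: "\<exists>s\<in>S. (s, v) \<in> R" using v by blast
  show "w \<in> S" if "(v, w) \<in> R" for w using ex step that v by blast
qed

text \<open>All outer vertices of a triangle attach antiparallel to the same side
  \<open>(t, s)\<close>, so every vertex other than \<open>s\<close> and \<open>t\<close> is the
  middle of a path of length two from \<open>s\<close> to \<open>t\<close>.\<close>

theorem theta_structure:
  obtains s t W where "V = insert s (insert t W)" "s \<noteq> t" "s \<notin> W" "t \<notin> W" "W \<noteq> {}"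
    "R = insert (t, s) (\<Union>w\<in>W. {(s, w), (w, t)})"
proof -
  have "card V \<ge> 2" using cardR by linarith
  then obtain x0 y0 where xy: "x0 \<in> V" "y0 \<in> V" "x0 \<noteq> y0"
    by (metis card_2_iff' obtain_subset_with_card_n subsetD)
  then have "(x0, y0) \<in> R\<^sup>*" using strongV unfolding strong_def by blast
  then obtain x1 y1 where "(x1, y1) \<in> R" using xy(3) by (metis converse_rtranclE)
  then obtain z1 where T1: "(x1, y1) \<in> R" "(y1, z1) \<in> R" "(z1, x1) \<in> R" "tight {x1, y1, z1}"
    using arc_in_triangle by metis
  text \<open>The ear through an outer vertex runs antiparallel to an arc of the triangle.\<close>
  have outer: "\<exists>s t. s \<in> S \<and> t \<in> S \<and> (t, s) \<in> R \<and> (\<forall>u. (u, v) \<in> R \<longleftrightarrow> u = s) \<and> (\<forall>u. (v, u) \<in> R \<longleftrightarrow> u = t)"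
    if S: "S = {x, y, z}" "(x, y) \<in> R" "(y, z) \<in> R" "(z, x) \<in> R" "tight S" and v: "v \<in> V" "v \<notin> S"
    for S x y z v
  proof -
    obtain s where s: "s \<in> S" "(s, v) \<in> R" using tight_outside[OF S(5) v] by blast
    obtain t where t: "t \<in> S" "(v, t) \<in> R"
      "arcs (insert v S) = insert (s, v) (insert (v, t) (arcs S))"
      using tight_out_neighbour[OF S(5) s v(2)] by metis
    have a: "u = s" if "(u, v) \<in> R" for u
    proof -
      have "u \<in> V" "u \<noteq> v" using that RV no_loop by auto
      then have "u \<in> S" using tight_outside(2)[OF S(5), of u v] that v by blast
      then have "(u, v) \<in> arcs (insert v S)" using that by blast
      with t(3) v(2) \<open>u \<noteq> v\<close> show "u = s" by auto
    qed
    have b: "u = t" if "(v, u) \<in> R" for u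
    proof -
      have "u \<in> S" using tight_outside(2)[OF S(5) v that] .
      then have "(v, u) \<in> arcs (insert v S)" using that by blast
      with t(3) v(2) s(1) show "u = t" by auto
    qed
    have "s \<noteq> t" using s t no2 by blast
    \<comment> \<open>Otherwise the path through \<open>v\<close> bypasses this arc. Two distinct
      vertices of the triangle are joined by an arc, so only \<open>(t, s)\<close> remains.\<close>
    moreover have "(s, t) \<notin> R"
    proof
      assume st: "(s, t) \<in> R"
      have "(s, t) \<in> {(s, v), (v, t)}\<^sup>*" by (meson insertI1 insertI2 r_into_rtrancl rtrancl_trans)
      moreover have "(s, t) \<notin> {(s, v), (v, t)}" using s t v by auto
      moreover have "{(s, v), (v, t)} \<subseteq> R" using s t by simp
      ultimately show False using irr st by (rule irredundant_bypass)
    qed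
    ultimately have "(t, s) \<in> R" using s(1) t(1) S by auto
    with s t a b show ?thesis by blast
  qed
  show thesis
  proof (cases "V = {x1, y1, z1}")
    case True
    \<comment> \<open>With no outer vertex, any side of the triangle can play the part of
      \<open>(t, s)\<close>.\<close>
    have "R = insert (x1, y1) (\<Union>w\<in>{z1}. {(y1, w), (w, x1)})"
      using T1 RV no2 no_loop unfolding True by auto
    then show thesis
      using that[of y1 x1 "{z1}"] True T1 no_loop by auto
  next
    case False
    have "{x1, y1, z1} \<subseteq> V" using T1 RV by blast
    then obtain v where v: "v \<in> V" "v \<notin> {x1, y1, z1}" using False by blast
    obtain s t where st: "s \<in> {x1, y1, z1}" "t \<in> {x1, y1, z1}" "(t, s) \<in> R"
      "\<And>u. (u, v) \<in> R \<longleftrightarrow> u = s" "\<And>u. (v, u) \<in> R \<longleftrightarrow> u = t"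
      using outer[OF refl T1 v] by blast
    obtain z where z: "{x1, y1, z1} = {t, s, z}" "(s, z) \<in> R" "(z, t) \<in> R"
    proof -
      have "(t, s) = (x1, y1) \<or> (t, s) = (y1, z1) \<or> (t, s) = (z1, x1)"
        using st(1-3) T1 no2 no_loop by blast
      then show thesis using T1 that by (elim disjE) (auto simp: insert_commute)
    qed
    let ?S = "{t, s, z}"
    have S: "tight ?S" and vS: "v \<notin> ?S" using T1 v z by auto
    \<comment> \<open>If \<open>w\<close> were antiparallel to a side other than
      \<open>(t, s)\<close>, the ears through \<open>v\<close> and \<open>w\<close> together would
      bypass the remaining side.\<close>
    have same: "(\<forall>u. (u, w) \<in> R \<longleftrightarrow> u = s) \<and> (\<forall>u. (w, u) \<in> R \<longleftrightarrow> u = t)" if w: "w \<in> V" "w \<notin> ?S" for w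
    proof -
      obtain s' t' where s': "s' \<in> ?S" "t' \<in> ?S" "(t', s') \<in> R"
        "\<And>u. (u, w) \<in> R \<longleftrightarrow> u = s'" "\<And>u. (w, u) \<in> R \<longleftrightarrow> u = t'"
        using outer[OF refl st(3) z(2,3) S w] by blast
      have d: "t \<noteq> s" "z \<noteq> s" "z \<noteq> t" using st z no_loop by auto
      have "\<not> (t' = s \<and> s' = z)"
      proof
        assume e: "t' = s \<and> s' = z"
        have "(z, t) \<in> {(z, w), (w, s), (s, v), (v, t)}\<^sup>*"
          by (meson insertI1 insertI2 r_into_rtrancl rtrancl_trans)
        moreover have "(z, t) \<notin> {(z, w), (w, s), (s, v), (v, t)}" using d w vS by auto
        moreover have "{(z, w), (w, s), (s, v), (v, t)} \<subseteq> R" using e s' st by auto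
        ultimately show False using irr z(3) by (rule irredundant_bypass)
      qed
      moreover have "\<not> (t' = z \<and> s' = t)"
      proof
        assume e: "t' = z \<and> s' = t"
        have "(s, z) \<in> {(s, v), (v, t), (t, w), (w, z)}\<^sup>*"
          by (meson insertI1 insertI2 r_into_rtrancl rtrancl_trans)
        moreover have "(s, z) \<notin> {(s, v), (v, t), (t, w), (w, z)}" using d w vS by auto
        moreover have "{(s, v), (v, t), (t, w), (w, z)} \<subseteq> R" using e s' st by auto
        ultimately show False using irr z(2) by (rule irredundant_bypass)
      qed
      ultimately have "s' = s \<and> t' = t" using s'(1-3) st(3) z(2,3) no2 no_loop by auto
      with s' show ?thesis by blast
    qed
    \<comment> \<open>The third triangle vertex \<open>z\<close> and the outer vertices play the
      same part.\<close>
    let ?W = "V - {s, t}"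
    have zV: "z \<in> V" "s \<in> V" "t \<in> V" using z RV by auto
    have d: "t \<noteq> s" "z \<noteq> s" "z \<noteq> t" using st z no_loop by auto
    have "(a, b) \<in> R \<longleftrightarrow> (a, b) \<in> insert (t, s) (\<Union>w\<in>?W. {(s, w), (w, t)})" for a b
    proof (cases "a \<in> V \<and> b \<in> V")
      case False
      then show ?thesis using RV zV by auto
    next
      case True
      consider "a \<notin> ?S" | "b \<notin> ?S" | "a \<in> ?S" "b \<in> ?S" by blast
      then show ?thesis
      proof cases
        case 1
        then show ?thesis using True same[of a] zV d by auto
      next
        case 2
        then show ?thesis using True same[of b] zV d by auto
      next
        case 3
        then show ?thesis using st(3) z(2,3) d no2 no_loop zV by auto
      qed
    qed
    then have "R = insert (t, s) (\<Union>w\<in>?W. {(s, w), (w, t)})" by auto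
    then show thesis using that[of s t ?W] zV d by auto
  qed
qed

end

section \<open>Contracting a perfect matching\<close>

definition bipartition :: "('v, 'e) multigraph \<Rightarrow> 'v set \<Rightarrow> 'v set \<Rightarrow> bool" where
  "bipartition G A B \<longleftrightarrow> wf_multigraph G \<and> A \<union> B = verts G \<and> A \<inter> B = {} \<and>
     (\<forall>e\<in>edges G. \<exists>a\<in>A. \<exists>b\<in>B. ends G e = {a, b})"

text \<open>Multiplicities are forgotten; nothing is lost for minimal graphs, which turn out to have
  no parallel edges.\<close>

definition adj_pairs :: "('v, 'e) multigraph \<Rightarrow> 'v set \<Rightarrow> 'v set \<Rightarrow> ('v \<times> 'v) set" where
  "adj_pairs G A B = {(a, b). a \<in> A \<and> b \<in> B \<and> (\<exists>e\<in>edges G. ends G e = {a, b})}"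

text \<open>A perfect matching, encoded by the bijection it induces between the colour classes.\<close>

definition matching_map :: "'v set \<Rightarrow> 'v set \<Rightarrow> ('v \<times> 'v) set \<Rightarrow> ('v \<Rightarrow> 'v) \<Rightarrow> bool" where
  "matching_map A B E \<mu> \<longleftrightarrow> bij_betw \<mu> A B \<and> (\<forall>a\<in>A. (a, \<mu> a) \<in> E)"

text \<open>Contract the matching edges and direct every other edge away from its end in \<open>A\<close>;
  the vertex arising from the edge \<open>{a, \<mu> a}\<close> is called \<open>a\<close>.\<close>

definition matching_digraph :: "'v set \<Rightarrow> ('v \<times> 'v) set \<Rightarrow> ('v \<Rightarrow> 'v) \<Rightarrow> ('v \<times> 'v) set" where
  "matching_digraph A E \<mu> = {(a, b). a \<in> A \<and> b \<in> A \<and> a \<noteq> b \<and> (a, \<mu> b) \<in> E}"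

lemma bipartition_pair_eq:
  assumes "bipartition G A B" "a \<in> A" "b \<in> B" "a' \<in> A" "b' \<in> B"
  shows "{a, b} = {a', b'} \<longleftrightarrow> a = a' \<and> b = b'"
  using assms unfolding bipartition_def by (auto simp: doubleton_eq_iff)

lemma perfect_matching_unique:
  assumes "perfect_matching G M" "v \<in> verts G" "e \<in> M" "f \<in> M" "v \<in> ends G e" "v \<in> ends G f"
  shows "e = f"
  using assms unfolding perfect_matching_def by blast

text \<open>The last conclusion turns an edge prescribed to lie in \<open>M\<close> into a
  prescribed value of \<open>\<mu>\<close>.\<close>

lemma matching_map_of_perfect_matching:
  assumes G: "bipartition G A B" and M: "perfect_matching G M"
  obtains \<mu> where "matching_map A B (adj_pairs G A B) \<mu>"
    "\<And>e a b. e \<in> M \<Longrightarrow> a \<in> A \<Longrightarrow> b \<in> B \<Longrightarrow> ends G e = {a, b} \<Longrightarrow> \<mu> a = b"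
proof -
  note pe = bipartition_pair_eq[OF G]
  have AB: "A \<subseteq> verts G" "B \<subseteq> verts G" and dis: "A \<inter> B = {}" and ME: "M \<subseteq> edges G"
    using G M unfolding bipartition_def perfect_matching_def by auto
  have ex: "\<exists>a\<in>A. \<exists>b\<in>B. ends G e = {a, b}" if "e \<in> M" for e
    using that ME G unfolding bipartition_def by blast
  have cov: "\<exists>e\<in>M. v \<in> ends G e" if "v \<in> verts G" for v
    using M that unfolding perfect_matching_def by blast
  have "\<exists>b. b \<in> B \<and> (\<exists>e\<in>M. ends G e = {a, b})" if a: "a \<in> A" for a
  proof -
    obtain e where e: "e \<in> M" "a \<in> ends G e" using cov AB a by blast
    then show ?thesis using ex[OF e(1)] dis a by fastforce
  qed
  then obtain \<mu> where \<mu>: "\<And>a. a \<in> A \<Longrightarrow> \<mu> a \<in> B" "\<And>a. a \<in> A \<Longrightarrow> \<exists>e\<in>M. ends G e = {a, \<mu> a}"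
    by metis
  have det: "\<mu> a = b" if ab: "e \<in> M" "a \<in> A" "b \<in> B" "ends G e = {a, b}" for e a b
  proof -
    obtain f where f: "f \<in> M" "ends G f = {a, \<mu> a}" using \<mu>(2) ab(2) by blast
    have "e = f"
      using perfect_matching_unique[OF M, of a e f] f ab AB by auto
    then show ?thesis using f ab pe[of a "\<mu> a" a b] \<mu>(1) by auto
  qed
  have "inj_on \<mu> A"
  proof (rule inj_onI)
    fix a a' assume a: "a \<in> A" "a' \<in> A" "\<mu> a = \<mu> a'"
    obtain e f where ef: "e \<in> M" "ends G e = {a, \<mu> a}" "f \<in> M" "ends G f = {a', \<mu> a}"
      using \<mu>(2) a by metis
    moreover have "\<mu> a \<in> verts G" using \<mu>(1)[OF a(1)] AB by blast
    ultimately have "e = f" using perfect_matching_unique[OF M, of "\<mu> a" e f] by auto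
    then show "a = a'" using ef pe[of a "\<mu> a" a' "\<mu> a"] \<mu>(1) a by auto
  qed
  moreover have "\<mu> ` A = B"
  proof
    show "B \<subseteq> \<mu> ` A"
    proof
      fix b assume b: "b \<in> B"
      obtain e where e: "e \<in> M" "b \<in> ends G e" using cov AB b by blast
      then obtain a b' where a: "a \<in> A" "b' \<in> B" "ends G e = {a, b'}" using ex by blast
      then have "b = b'" using e dis b by auto
      then show "b \<in> \<mu> ` A" using det[OF e(1) a] a by blast
    qed
  qed (use \<mu> in blast)
  ultimately have "matching_map A B (adj_pairs G A B) \<mu>"
    using \<mu> ME unfolding matching_map_def adj_pairs_def bij_betw_def by blast
  then show thesis using that det by blast
qed

text \<open>Injectivity of \<open>ends\<close> matters here: the set would contain all copies of a
  parallel edge.\<close>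

lemma perfect_matching_of_matching_map:
  assumes G: "bipartition G A B" and inj: "inj_on (ends G) (edges G)"
    and \<mu>: "matching_map A B (adj_pairs G A B) \<mu>"
  shows "perfect_matching G {e \<in> edges G. \<exists>a\<in>A. ends G e = {a, \<mu> a}}"
proof -
  note pe = bipartition_pair_eq[OF G]
  let ?M = "{e \<in> edges G. \<exists>a\<in>A. ends G e = {a, \<mu> a}}"
  have dis: "A \<inter> B = {}" and V: "verts G = A \<union> B" using G unfolding bipartition_def by auto
  have \<mu>AB: "\<mu> ` A = B" "inj_on \<mu> A" using \<mu> unfolding matching_map_def bij_betw_def by auto
  have one: "\<exists>!e. e \<in> ?M \<and> v \<in> ends G e" if v: "v = a \<or> v = \<mu> a" and a: "a \<in> A" for v a
  proof -
    obtain e where e: "e \<in> edges G" "ends G e = {a, \<mu> a}"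
      using \<mu> a unfolding matching_map_def adj_pairs_def by blast
    show ?thesis
    proof (rule ex1I[of _ e])
      show "e \<in> ?M \<and> v \<in> ends G e" using e a v by auto
    next
      fix f assume f: "f \<in> ?M \<and> v \<in> ends G f"
      then obtain a' where a': "a' \<in> A" "ends G f = {a', \<mu> a'}" by blast
      have "a = a'"
        using f a' v a dis \<mu>AB by (auto dest: inj_onD)
      then show "f = e" using inj_onD[OF inj, of f e] e f a' by simp
    qed
  qed
  show ?thesis
    unfolding perfect_matching_def
  proof (intro conjI ballI)
    fix v assume "v \<in> verts G"
    then obtain a where "a \<in> A" "v = a \<or> v = \<mu> a" using V \<mu>AB by blast
    then show "\<exists>!e. e \<in> ?M \<and> v \<in> ends G e" by (rule one[rotated])
  qed blast
qed

lemma finite_bipartition: "bipartition G A B \<Longrightarrow> finite A \<and> finite B"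
  unfolding bipartition_def wf_multigraph_def by (metis finite_Un)

lemma matching_covered_imp_strong:
  assumes G: "bipartition G A B" and mc: "matching_covered G"
    and \<mu>: "matching_map A B (adj_pairs G A B) \<mu>"
  shows "strong A (matching_digraph A (adj_pairs G A B) \<mu>)"
  unfolding strong_def
proof (intro ballI, rule ccontr)
  let ?E = "adj_pairs G A B" and ?R = "matching_digraph A (adj_pairs G A B) \<mu>"
  fix s v assume s: "s \<in> A" "v \<in> A" "(s, v) \<notin> ?R\<^sup>*"
  text \<open>The neighbourhood of the set \<open>X\<close> of vertices reachable from \<open>s\<close> has the size of \<open>X\<close>,
    so a perfect matching has no edge from outside \<open>X\<close> to this neighbourhood.\<close>
  define X where "X = {a \<in> A. (s, a) \<in> ?R\<^sup>*}"
  have X: "X \<subseteq> A" "s \<in> X" "v \<notin> X" unfolding X_def using s by auto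
  have \<mu>AB: "\<mu> ` A = B" "inj_on \<mu> A" using \<mu> unfolding matching_map_def bij_betw_def by auto
  have dis: "A \<inter> B = {}" and V: "verts G = A \<union> B" and fin: "finite A"
    using G finite_bipartition[OF G] unfolding bipartition_def by auto
  have closed: "b \<in> \<mu> ` X" if "a \<in> X" "(a, b) \<in> ?E" for a b
  proof -
    have "b \<in> B" using that(2) unfolding adj_pairs_def by blast
    then obtain c where c: "c \<in> A" "b = \<mu> c" using \<mu>AB by blast
    have "c \<in> X"
    proof (cases "a = c")
      case False
      then have "(a, c) \<in> ?R" using that c X unfolding matching_digraph_def by auto
      then show ?thesis using that(1) c unfolding X_def by (auto intro: rtrancl_into_rtrancl)
    qed (use that in simp)
    then show ?thesis using c by blast
  qed
  have "(s, v) \<in> (adjacency G)\<^sup>*"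
    using mc s V unfolding matching_covered_def connected_graph_def by blast
  moreover have "v \<notin> X \<union> \<mu> ` X" using X s(2) \<mu>AB dis by blast
  ultimately obtain p q where pq: "(p, q) \<in> adjacency G" "p \<in> X \<union> \<mu> ` X" "q \<notin> X \<union> \<mu> ` X"
    using X(2) rtrancl_leaves_set[of s v _ "X \<union> \<mu> ` X"] by blast
  then obtain e where e: "e \<in> edges G" "ends G e = {p, q}" unfolding adjacency_def by blast
  then obtain a b where ab: "a \<in> A" "b \<in> B" "ends G e = {a, b}"
    using G unfolding bipartition_def by blast
  then have abE: "(a, b) \<in> ?E" unfolding adj_pairs_def using e by auto
  \<comment> \<open>By \<open>closed\<close>, an edge whose \<open>A\<close>-end lies in
    \<open>X\<close> stays inside. So the edge that leaves has its \<open>B\<close>-end in the image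
    of \<open>X\<close> and its \<open>A\<close>-end outside \<open>X\<close>.\<close>
  have "a \<notin> X" using closed[OF _ abE] pq(2,3) ab(3) e(2) by (auto simp: doubleton_eq_iff)
  moreover have "b \<in> \<mu> ` X"
  proof -
    have "a \<notin> \<mu> ` X" "b \<notin> X" using ab(1,2) \<mu>AB dis X(1) by blast+
    moreover have "p = a \<or> p = b" using ab(3) e(2) by (auto simp: doubleton_eq_iff)
    ultimately show ?thesis using \<open>a \<notin> X\<close> pq(2) by blast
  qed
  moreover obtain N where N: "perfect_matching G N" "e \<in> N"
    using mc e(1) unfolding matching_covered_def by blast
  obtain \<nu> where \<nu>: "matching_map A B ?E \<nu>" "\<nu> a = b"
    using matching_map_of_perfect_matching[OF G N(1)] N(2) ab by metis
  have \<nu>i: "inj_on \<nu> A" and "\<nu> ` X \<subseteq> \<mu> ` X"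
    using \<nu>(1) closed X(1) unfolding matching_map_def bij_betw_def by auto
  moreover have "card (\<nu> ` X) = card (\<mu> ` X)"
    using \<nu>i \<mu>AB(2) X(1) by (metis card_image inj_on_subset)
  ultimately have "\<nu> ` X = \<mu> ` X" using fin X(1) by (meson card_subset_eq finite_imageI finite_subset)
  then have "a \<in> X" using \<open>b \<in> \<mu> ` X\<close> \<nu>(2) \<nu>i ab(1) X(1) by (auto dest: inj_onD)
  with \<open>a \<notin> X\<close> show False by blast
qed

text \<open>An edge outside the matching is an arc \<open>(a, b)\<close>. A path back from
  \<open>b\<close> to \<open>a\<close> closes it to a directed cycle, and exchanging
  \<open>\<mu>\<close> along this cycle gives a perfect matching through the edge.\<close>

lemma strong_imp_matching_covered:
  assumes G: "bipartition G A B" and inj: "inj_on (ends G) (edges G)"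
    and \<mu>: "matching_map A B (adj_pairs G A B) \<mu>"
    and str: "strong A (matching_digraph A (adj_pairs G A B) \<mu>)" and n: "4 \<le> card (verts G)"
  shows "matching_covered G"
proof -
  let ?E = "adj_pairs G A B" and ?R = "matching_digraph A (adj_pairs G A B) \<mu>"
  let ?J = "(adjacency G)\<^sup>*"
  have \<mu>AB: "\<mu> ` A = B" "inj_on \<mu> A" and b\<mu>: "bij_betw \<mu> A B"
    using \<mu> unfolding matching_map_def bij_betw_def by auto
  have V: "verts G = A \<union> B" and wf: "wf_multigraph G" using G unfolding bipartition_def by auto
  have adj: "(a, b) \<in> ?J" "(b, a) \<in> ?J" if "(a, b) \<in> ?E" for a b
    using that unfolding adj_pairs_def adjacency_def by (auto simp: insert_commute)
  have \<mu>J: "(a, \<mu> a) \<in> ?J" "(\<mu> a, a) \<in> ?J" if "a \<in> A" for a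
    using that \<mu> adj unfolding matching_map_def by blast+
  have "?R \<subseteq> ?J"
  proof clarify
    fix a b assume "(a, b) \<in> ?R"
    then have "(a, \<mu> b) \<in> ?J" "(\<mu> b, b) \<in> ?J"
      using adj(1) \<mu>J(2) unfolding matching_digraph_def by auto
    then show "(a, b) \<in> ?J" by (rule rtrancl_trans)
  qed
  then have RJ: "?R\<^sup>* \<subseteq> ?J" by (metis rtrancl_mono rtrancl_idemp)
  have "(u, v) \<in> ?J" if uv: "u \<in> verts G" "v \<in> verts G" for u v
  proof -
    have root: "\<exists>a\<in>A. (w, a) \<in> ?J \<and> (a, w) \<in> ?J" if "w \<in> verts G" for w
      using that V \<mu>AB \<mu>J by blast
    obtain a b where "a \<in> A" "(u, a) \<in> ?J" "b \<in> A" "(b, v) \<in> ?J" using root uv by blast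
    moreover have "(a, b) \<in> ?J" using str calculation RJ unfolding strong_def by blast
    ultimately show ?thesis by (meson rtrancl_trans)
  qed
  moreover have "verts G \<noteq> {}" using n by auto
  ultimately have conn: "connected_graph G" unfolding connected_graph_def by blast
  have "\<exists>M. perfect_matching G M \<and> f \<in> M" if f: "f \<in> edges G" for f
  proof -
    obtain a b' where ab: "a \<in> A" "b' \<in> B" "ends G f = {a, b'}"
      using G f unfolding bipartition_def by blast
    then obtain b where b: "b \<in> A" "b' = \<mu> b" using \<mu>AB by blast
    have fE: "(a, \<mu> b) \<in> ?E" using ab b f unfolding adj_pairs_def by blast
    have "\<exists>\<nu>. matching_map A B ?E \<nu> \<and> \<nu> a = b'"
    proof (cases "a = b")
      case True
      then show ?thesis using \<mu> b by blast
    next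
      case False
      then have aR: "(a, b) \<in> ?R" using fE ab b unfolding matching_digraph_def by blast
      have "(b, a) \<in> ?R\<^sup>*" using str ab b unfolding strong_def by blast
      then obtain xs where xs: "walk ?R xs" "distinct xs" "hd xs = b" "last xs = a"
        by (rule rtrancl_distinct_walk)
      obtain \<sigma> where \<sigma>: "\<sigma> permutes set xs" "\<sigma> a = b"
        "\<And>x. x \<in> set xs \<Longrightarrow> x \<noteq> a \<Longrightarrow> (x, \<sigma> x) \<in> ?R"
        using distinct_walk_cyclic_permutation[OF xs(1,2)] unfolding xs(3,4) by blast
      have \<sigma>R: "(x, \<sigma> x) \<in> ?R" if "x \<in> set xs" for x using \<sigma>(2,3) aR that by (cases "x = a") auto
      have "set xs \<subseteq> A" using \<sigma>R unfolding matching_digraph_def by blast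
      then have "\<sigma> permutes A" using \<sigma>(1) by (rule permutes_subset[rotated])
      then have "bij_betw (\<mu> \<circ> \<sigma>) A B" using b\<mu> bij_betw_trans permutes_imp_bij by blast
      moreover have "(x, (\<mu> \<circ> \<sigma>) x) \<in> ?E" if "x \<in> A" for x
      proof (cases "x \<in> set xs")
        case True
        then show ?thesis using \<sigma>R unfolding matching_digraph_def by auto
      next
        case False
        then show ?thesis using \<sigma>(1) \<mu> that unfolding matching_map_def by (simp add: permutes_not_in)
      qed
      ultimately show ?thesis using \<sigma>(2) b unfolding matching_map_def by (intro exI[of _ "\<mu> \<circ> \<sigma>"]) auto
    qed
    then obtain \<nu> where "matching_map A B ?E \<nu>" "\<nu> a = b'" by blast
    then show ?thesis
      using perfect_matching_of_matching_map[OF G inj] f ab by blast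
  qed
  then show ?thesis using wf conn n unfolding matching_covered_def by blast
qed

section \<open>Consequences of minimality\<close>

lemma bipartition_delete_edge:
  "bipartition G A B \<Longrightarrow> bipartition (delete_edge G e) A B"
  unfolding bipartition_def wf_multigraph_def delete_edge_def by auto

text \<open>Of two parallel edges one can be deleted: adjacency is unchanged, and every perfect
  matching using the deleted edge can use the other one instead.\<close>

lemma minimal_matching_covered_simple:
  assumes min: "minimal_matching_covered G"
  shows "inj_on (ends G) (edges G)"
proof (rule inj_onI, rule ccontr)
  fix e f assume e: "e \<in> edges G" "f \<in> edges G" "ends G e = ends G f" "e \<noteq> f"
  let ?H = "delete_edge G e"
  have mc: "matching_covered G" using min unfolding minimal_matching_covered_def by blast
  have "(\<exists>g\<in>edges G - {e}. ends G g = S) \<longleftrightarrow> (\<exists>g\<in>edges G. ends G g = S)" for S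
    using e by (metis Diff_iff singletonD)
  then have "adjacency ?H = adjacency G" unfolding adjacency_def delete_edge_def by simp
  then have conn: "connected_graph ?H"
    using mc unfolding matching_covered_def connected_graph_def delete_edge_def by auto
  have "wf_multigraph ?H"
    using mc unfolding matching_covered_def wf_multigraph_def delete_edge_def by auto
  moreover have "\<exists>M. perfect_matching ?H M \<and> g \<in> M" if g: "g \<in> edges ?H" for g
  proof -
    have g': "g \<in> edges G" "g \<noteq> e" using g unfolding delete_edge_def by auto
    then obtain M where M: "perfect_matching G M" "g \<in> M" using mc unfolding matching_covered_def by blast
    have simps: "verts ?H = verts G" "edges ?H = edges G - {e}" "ends ?H = ends G"
      unfolding delete_edge_def by auto
    show ?thesis
    proof (cases "e \<in> M")
      case False
      then have "perfect_matching ?H M" using M unfolding perfect_matching_def simps by blast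
      then show ?thesis using M by blast
    next
      case True
      have ne: "ends G e \<noteq> {}" "ends G e \<subseteq> verts G"
        using mc e(1) unfolding matching_covered_def wf_multigraph_def by force+
      have fM: "f \<notin> M"
        using perfect_matching_unique[OF M(1) _ True, of _ f] e ne by blast
      have "perfect_matching ?H (insert f (M - {e}))"
        unfolding perfect_matching_def simps
      proof (intro conjI ballI)
        fix v assume v: "v \<in> verts G"
        then obtain h where h: "h \<in> M" "v \<in> ends G h" "\<And>h'. h' \<in> M \<Longrightarrow> v \<in> ends G h' \<Longrightarrow> h' = h"
          using M(1) unfolding perfect_matching_def by blast
        show "\<exists>!h. h \<in> insert f (M - {e}) \<and> v \<in> ends G h"
        proof (cases "h = e")
          case True
          then have "v \<in> ends G f" using h(2) e(3) by simp
          moreover have "v \<notin> ends G x" if "x \<in> M - {e}" for x using h(3) True that by blast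
          ultimately show ?thesis by blast
        next
          case False
          then have "v \<notin> ends G f" "h \<in> M - {e}" using h(1) h(3)[OF True] e(3) by auto
          then show ?thesis using h by blast
        qed
      qed (use M e in \<open>auto simp: perfect_matching_def\<close>)
      then show ?thesis using M g' by blast
    qed
  qed
  moreover have "4 \<le> card (verts ?H)" using mc unfolding matching_covered_def delete_edge_def by simp
  ultimately have "matching_covered ?H" using conn unfolding matching_covered_def by blast
  then show False using min e(1) unfolding minimal_matching_covered_def by blast
qed

text \<open>Deleting the edge behind an arc removes just this arc and keeps \<open>\<mu>\<close> a
  matching. If the arc could be bypassed, the digraph would stay strong and the smaller graph
  matching covered.\<close>

lemma minimal_matching_covered_irredundant:
  assumes G: "bipartition G A B" and min: "minimal_matching_covered G"
    and \<mu>: "matching_map A B (adj_pairs G A B) \<mu>"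
  shows "irredundant (matching_digraph A (adj_pairs G A B) \<mu>)"
proof -
  let ?E = "adj_pairs G A B" and ?R = "matching_digraph A (adj_pairs G A B) \<mu>"
  note pe = bipartition_pair_eq[OF G]
  have mc: "matching_covered G" using min unfolding minimal_matching_covered_def by blast
  have \<mu>AB: "\<mu> ` A = B" "inj_on \<mu> A" using \<mu> unfolding matching_map_def bij_betw_def by auto
  have inj: "inj_on (ends G) (edges G)" using min by (rule minimal_matching_covered_simple)
  have str: "strong A ?R" using matching_covered_imp_strong[OF G mc \<mu>] .
  have False if ab: "(a, b) \<in> ?R" and by_pass: "(a, b) \<in> (?R - {(a, b)})\<^sup>*" for a b
  proof -
    have aA: "a \<in> A" "b \<in> A" "a \<noteq> b" "(a, \<mu> b) \<in> ?E" using ab unfolding matching_digraph_def by auto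
    have \<mu>b: "\<mu> b \<in> B" using aA \<mu>AB by blast
    have \<mu>b_eq: "\<mu> c = \<mu> b \<longleftrightarrow> c = b" if "c \<in> A" for c
      using \<mu>AB(2) that aA(2) by (rule inj_on_eq_iff)
    obtain e where e: "e \<in> edges G" "ends G e = {a, \<mu> b}" using aA(4) unfolding adj_pairs_def by blast
    let ?H = "delete_edge G e"
    have H: "bipartition ?H A B" using G by (rule bipartition_delete_edge)
    have del: "(\<exists>g\<in>edges G - {e}. ends G g = S) \<longleftrightarrow>
        (\<exists>g\<in>edges G. ends G g = S) \<and> S \<noteq> {a, \<mu> b}" for S
      using e inj unfolding inj_on_def by (metis Diff_iff singletonD singletonI)
    have EH: "adj_pairs ?H A B = ?E - {(a, \<mu> b)}"
      using pe[OF _ _ aA(1) \<mu>b] unfolding adj_pairs_def delete_edge_def by (auto simp: del)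
    have RH: "matching_digraph A (adj_pairs ?H A B) \<mu> = ?R - {(a, b)}"
      unfolding EH matching_digraph_def using \<mu>b_eq aA by auto
    have "matching_map A B (adj_pairs ?H A B) \<mu>"
      using \<mu> \<mu>b_eq aA unfolding matching_map_def EH by auto
    moreover have "strong A (?R - {(a, b)})"
    proof -
      have "(c, d) \<in> (?R - {(a, b)})\<^sup>*" if "(c, d) \<in> ?R" for c d
      proof (cases "(c, d) = (a, b)")
        case True
        then show ?thesis using by_pass by simp
      next
        case False
        then show ?thesis using that by (intro r_into_rtrancl) simp
      qed
      then have "?R \<subseteq> (?R - {(a, b)})\<^sup>*" by (rule subrelI)
      then have "?R\<^sup>* \<subseteq> (?R - {(a, b)})\<^sup>*" by (metis rtrancl_mono rtrancl_idemp)
      then show ?thesis using str unfolding strong_def by blast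
    qed
    moreover have "inj_on (ends ?H) (edges ?H)" using inj unfolding delete_edge_def by (auto simp: inj_on_def)
    moreover have "4 \<le> card (verts ?H)" using mc unfolding matching_covered_def delete_edge_def by simp
    ultimately have "matching_covered ?H" using strong_imp_matching_covered[OF H] RH by simp
    then show False using min e(1) unfolding minimal_matching_covered_def by blast
  qed
  then show ?thesis unfolding irredundant_def by blast
qed

text \<open>The third vertex \<open>z\<close> provides an ear of \<open>{x, y}\<close>; without it
  the 4-cycle would be a counterexample. If the ends of the ear differ, it bypasses an arc of the
  2-cycle. If they agree, the matching is changed, which is why \<open>mm\<close> speaks of all
  matchings.\<close>

lemma irredundant_matching_digraph_no_2_cycle:
  assumes mm: "\<And>\<mu>. matching_map A B E \<mu> \<Longrightarrow>
      strong A (matching_digraph A E \<mu>) \<and> irredundant (matching_digraph A E \<mu>)"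
    and \<mu>: "matching_map A B E \<mu>"
    and xy: "(x, y) \<in> matching_digraph A E \<mu>" "(y, x) \<in> matching_digraph A E \<mu>"
    and z: "z \<in> A" "z \<noteq> x" "z \<noteq> y"
  shows False
proof -
  let ?R = "matching_digraph A E \<mu>"
  let ?S = "{x, y}"
  define \<nu> where "\<nu> = \<mu>(x := \<mu> y, y := \<mu> x)"
  let ?Q = "matching_digraph A E \<nu>"
  have xyA: "x \<in> A" "y \<in> A" "x \<noteq> y" "(x, \<mu> y) \<in> E" "(y, \<mu> x) \<in> E"
    using xy unfolding matching_digraph_def by auto
  have \<nu>: "matching_map A B E \<nu>"
  proof -
    have "\<nu> = \<mu> \<circ> transpose x y" unfolding \<nu>_def by (auto simp: transpose_def fun_eq_iff)
    moreover have "transpose x y permutes A" using xyA by (intro permutes_swap_id)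
    ultimately have "bij_betw \<nu> A B"
      using \<mu> bij_betw_trans permutes_imp_bij unfolding matching_map_def by blast
    then show ?thesis using \<mu> xyA unfolding matching_map_def \<nu>_def by auto
  qed
  have irr: "irredundant ?R" "irredundant ?Q" and str: "strong A ?R" using mm \<mu> \<nu> by blast+
  have "(x, z) \<in> ?R\<^sup>*" "(z, x) \<in> ?R\<^sup>*" using str z xyA unfolding strong_def by auto
  obtain s v where sv: "(s, v) \<in> ?R" "s \<in> ?S" "v \<notin> ?S"
    using rtrancl_leaves_set[OF \<open>(x, z) \<in> ?R\<^sup>*\<close>, of ?S] z by auto
  have "(v, x) \<in> ?R\<^sup>*" using str sv xyA unfolding strong_def matching_digraph_def by auto
  then obtain u t where u: "(v, u) \<in> (?R \<inter> (- ?S) \<times> (- ?S))\<^sup>*" "u \<notin> ?S" "(u, t) \<in> ?R" "t \<in> ?S"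
    using rtrancl_enters_set[of v x ?R ?S] sv(3) by auto
  let ?P = "?R \<inter> (- ?S) \<times> (- ?S)"
  have path: "(p, q) \<in> (insert (p, v) (insert (u, q) ?P))\<^sup>*" for p q
  proof -
    have "(v, u) \<in> (insert (p, v) (insert (u, q) ?P))\<^sup>*"
      using u(1) rtrancl_mono[of ?P "insert (p, v) (insert (u, q) ?P)"] by blast
    then show ?thesis
      by (meson insertI1 insertI2 converse_rtrancl_into_rtrancl rtrancl_into_rtrancl)
  qed
  have off: "(p, q) \<notin> insert (p, v) (insert (u, q) ?P)" if "p \<in> ?S" "q \<in> ?S" for p q
    using that sv(3) u(2) by auto
  show False
  proof (cases "s = t")
    case False
    have "insert (s, v) (insert (u, t) ?P) \<subseteq> ?R" using sv u by blast
    moreover have "(s, t) \<in> ?R" using False sv u xy by auto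
    ultimately show False
      using irredundant_bypass[OF path off _ irr(1)] sv(2) u(4) by blast
  next
    case True
    text \<open>Exchanging the matching edges of the 4-cycle turns the ear with equal ends at \<open>s\<close>
      into one that bypasses the arc between \<open>x\<close> and \<open>y\<close>.\<close>
    define t' where "t' = (if s = x then y else x)"
    have t': "t' \<in> ?S" "t' \<noteq> s" "t' \<in> A" "s \<in> A" "\<nu> t' = \<mu> s" unfolding t'_def \<nu>_def using sv(2) xyA by auto
    have same: "\<nu> w = \<mu> w" if "w \<notin> ?S" for w using that unfolding \<nu>_def by auto
    have "?P \<subseteq> ?Q" unfolding matching_digraph_def using same by auto
    moreover have "(s, v) \<in> ?Q" using sv same[of v] unfolding matching_digraph_def by auto
    \<comment> \<open>As \<open>\<nu> t' = \<mu> s\<close>, the edge that entered \<open>s\<close>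
      now enters \<open>t'\<close>, and the former matching edge at \<open>s\<close> becomes the arc
      \<open>(s, t')\<close>.\<close>
    moreover have "(u, t') \<in> ?Q" using u t' True unfolding matching_digraph_def by auto
    ultimately have "insert (s, v) (insert (u, t') ?P) \<subseteq> ?Q" by blast
    moreover have "(s, t') \<in> ?Q" using t' \<mu> unfolding matching_digraph_def matching_map_def by auto
    ultimately show False
      using irredundant_bypass[OF path off _ irr(2)] sv(2) t'(1) by blast
  qed
qed

section \<open>Isomorphism invariance\<close>

lemma wf_ends_subset: "wf_multigraph G \<Longrightarrow> e \<in> edges G \<Longrightarrow> ends G e \<subseteq> verts G"
  unfolding wf_multigraph_def by blast

lemma isomorphicE:
  assumes "isomorphic G H"
  obtains f g where "inj_on f (verts G)" "verts H = f ` verts G" "inj_on g (edges G)"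
    "edges H = g ` edges G" "\<And>e. e \<in> edges G \<Longrightarrow> ends H (g e) = f ` ends G e"
  using assms unfolding isomorphic_def bij_betw_def by metis

text \<open>Well-formedness keeps the ends inside the vertex set, where \<open>inv_into\<close>
  undoes \<open>f\<close>.\<close>

lemma isomorphic_sym:
  assumes wf: "wf_multigraph G" and iso: "isomorphic G H"
  shows "isomorphic H G"
proof -
  obtain f g where f: "bij_betw f (verts G) (verts H)" and g: "bij_betw g (edges G) (edges H)"
    and e: "\<And>e. e \<in> edges G \<Longrightarrow> ends H (g e) = f ` ends G e"
    using iso unfolding isomorphic_def by blast
  let ?f = "inv_into (verts G) f" and ?g = "inv_into (edges G) g"
  have "ends G (?g e') = ?f ` ends H e'" if e': "e' \<in> edges H" for e'
  proof -
    have "?g e' \<in> edges G" "g (?g e') = e'"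
      using g e' unfolding bij_betw_def by (auto simp: inv_into_into f_inv_into_f)
    then have "ends H e' = f ` ends G (?g e')" "ends G (?g e') \<subseteq> verts G"
      using e wf_ends_subset[OF wf] by metis+
    then show ?thesis using f unfolding bij_betw_def by simp
  qed
  then show ?thesis
    unfolding isomorphic_def using bij_betw_inv_into[OF f] bij_betw_inv_into[OF g] by blast
qed

lemma wf_multigraph_isomorphic:
  assumes wf: "wf_multigraph G" and iso: "isomorphic G H"
  shows "wf_multigraph H"
proof -
  obtain f g where f: "inj_on f (verts G)" "verts H = f ` verts G" and g: "edges H = g ` edges G"
    and e: "\<And>e. e \<in> edges G \<Longrightarrow> ends H (g e) = f ` ends G e"
    by (rule isomorphicE[OF iso]) blast
  have "f ` ends G e \<subseteq> f ` verts G" "card (f ` ends G e) = 2" if "e \<in> edges G" for e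
    using wf that f(1) unfolding wf_multigraph_def by (auto simp: card_image inj_on_subset)
  then show ?thesis using wf f g e unfolding wf_multigraph_def by auto
qed

lemma bipartite_isomorphic:
  assumes bip: "bipartite G" and iso: "isomorphic G H"
  shows "bipartite H"
proof -
  obtain f g where f: "inj_on f (verts G)" "verts H = f ` verts G" and g: "edges H = g ` edges G"
    and e: "\<And>e. e \<in> edges G \<Longrightarrow> ends H (g e) = f ` ends G e"
    by (rule isomorphicE[OF iso]) blast
  obtain A B where AB: "A \<union> B = verts G" "A \<inter> B = {}"
    "\<forall>e\<in>edges G. \<exists>a\<in>A. \<exists>b\<in>B. ends G e = {a, b}"
    using bip unfolding bipartite_def by blast
  have "f ` A \<union> f ` B = verts H" using AB f by auto
  moreover have "f ` A \<inter> f ` B = {}"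
    using AB(1,2) inj_on_image_Int[OF f(1), of A B] by auto
  moreover have "\<exists>a\<in>f ` A. \<exists>b\<in>f ` B. ends H e' = {a, b}" if e': "e' \<in> edges H" for e'
  proof -
    obtain e0 where "e0 \<in> edges G" "e' = g e0" using e' g by blast
    moreover then obtain a b where "a \<in> A" "b \<in> B" "ends G e0 = {a, b}" using AB(3) by blast
    ultimately show ?thesis using e by auto
  qed
  ultimately show ?thesis
    unfolding bipartite_def by (intro exI[of _ "f ` A"] exI[of _ "f ` B"]) simp
qed

lemma matching_covered_isomorphic:
  assumes mc: "matching_covered G" and iso: "isomorphic G H"
  shows "matching_covered H"
proof -
  have wf: "wf_multigraph G" using mc unfolding matching_covered_def by blast
  obtain f g where f: "inj_on f (verts G)" "verts H = f ` verts G"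
    and g: "inj_on g (edges G)" "edges H = g ` edges G"
    and e: "\<And>e. e \<in> edges G \<Longrightarrow> ends H (g e) = f ` ends G e"
    by (rule isomorphicE[OF iso]) blast
  have mem: "f v \<in> ends H (g h) \<longleftrightarrow> v \<in> ends G h" if "v \<in> verts G" "h \<in> edges G" for v h
    using e[OF that(2)] wf_ends_subset[OF wf that(2)] f(1) that(1) by (simp add: inj_on_image_mem_iff)
  have step: "(f u, f v) \<in> (adjacency H)\<^sup>*" if "(u, v) \<in> (adjacency G)\<^sup>*" for u v
    using that
  proof (induction rule: rtrancl_induct)
    case (step v w)
    then obtain h where h: "h \<in> edges G" "ends G h = {v, w}" unfolding adjacency_def by blast
    then have "(f v, f w) \<in> adjacency H" using e g(2) unfolding adjacency_def by force
    with step.IH show ?case by (rule rtrancl_into_rtrancl)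
  qed simp
  have "connected_graph H"
    using mc f step unfolding matching_covered_def connected_graph_def by auto
  moreover have "\<exists>M. perfect_matching H M \<and> e' \<in> M" if e': "e' \<in> edges H" for e'
  proof -
    obtain e0 where e0: "e0 \<in> edges G" "e' = g e0" using e' g by blast
    then obtain M where M: "perfect_matching G M" "e0 \<in> M"
      using mc unfolding matching_covered_def by blast
    have MG: "M \<subseteq> edges G" using M unfolding perfect_matching_def by blast
    have "\<exists>!h. h \<in> g ` M \<and> f v \<in> ends H h" if v: "v \<in> verts G" for v
    proof -
      obtain h where h: "h \<in> M" "v \<in> ends G h" using M(1) v unfolding perfect_matching_def by blast
      show ?thesis
      proof (rule ex1I[of _ "g h"])
        show "g h \<in> g ` M \<and> f v \<in> ends H (g h)" using h mem[OF v] MG by blast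
      next
        fix k assume "k \<in> g ` M \<and> f v \<in> ends H k"
        then obtain k' where k': "k' \<in> M" "k = g k'" "v \<in> ends G k'" using mem[OF v] MG by blast
        then show "k = g h" using perfect_matching_unique[OF M(1) v k'(1) h(1)] h by simp
      qed
    qed
    then have "perfect_matching H (g ` M)"
      using MG g(2) f(2) unfolding perfect_matching_def by auto
    then show ?thesis using M(2) e0(2) by blast
  qed
  moreover have "4 \<le> card (verts H)" using mc f unfolding matching_covered_def by (simp add: card_image)
  ultimately show ?thesis
    using wf_multigraph_isomorphic[OF wf iso] unfolding matching_covered_def by blast
qed

lemma isomorphic_delete_edge:
  assumes iso: "isomorphic G H" and e': "e' \<in> edges H"
  obtains e where "e \<in> edges G" "isomorphic (delete_edge G e) (delete_edge H e')"
proof -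
  obtain f g where f: "bij_betw f (verts G) (verts H)" and g: "bij_betw g (edges G) (edges H)"
    and e: "\<And>e. e \<in> edges G \<Longrightarrow> ends H (g e) = f ` ends G e"
    using iso unfolding isomorphic_def by blast
  obtain e0 where e0: "e0 \<in> edges G" "e' = g e0" using g e' unfolding bij_betw_def by blast
  have "bij_betw g (edges G - {e0}) (edges H - {e'})"
    using bij_betw_DiffI[OF g, of "{e0}" "{e'}"] e0 e' by (simp add: bij_betw_def)
  then have "isomorphic (delete_edge G e0) (delete_edge H e')"
    unfolding isomorphic_def delete_edge_def using f e by (intro exI[of _ f] exI[of _ g]) auto
  then show thesis using that e0(1) by blast
qed

lemma minimal_matching_covered_isomorphic:
  assumes min: "minimal_matching_covered G" and iso: "isomorphic G H"
  shows "minimal_matching_covered H"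
proof -
  have mc: "matching_covered G" using min unfolding minimal_matching_covered_def by blast
  have False if e': "e' \<in> edges H" and mc': "matching_covered (delete_edge H e')" for e'
  proof -
    obtain e where e: "e \<in> edges G" "isomorphic (delete_edge G e) (delete_edge H e')"
      using iso e' by (rule isomorphic_delete_edge)
    have "wf_multigraph (delete_edge G e)"
      using mc unfolding matching_covered_def wf_multigraph_def delete_edge_def by auto
    then have "matching_covered (delete_edge G e)"
      using isomorphic_sym e(2) matching_covered_isomorphic[OF mc'] by blast
    then show False using min e(1) unfolding minimal_matching_covered_def by blast
  qed
  then show ?thesis
    using matching_covered_isomorphic[OF mc iso] unfolding minimal_matching_covered_def by blast
qed

lemma card_isomorphic:
  assumes wf: "wf_multigraph G" and iso: "isomorphic G H"
  shows "card (verts H) = card (verts G)" "card (edges H) = card (edges G)"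
    "card (V2 H) = card (V2 G)"
proof -
  obtain f g where f: "inj_on f (verts G)" "verts H = f ` verts G"
    and g: "inj_on g (edges G)" "edges H = g ` edges G"
    and e: "\<And>e. e \<in> edges G \<Longrightarrow> ends H (g e) = f ` ends G e"
    by (rule isomorphicE[OF iso]) blast
  show "card (verts H) = card (verts G)" "card (edges H) = card (edges G)"
    using f g by (auto simp: card_image)
  have deg: "degree H (f v) = degree G v" if v: "v \<in> verts G" for v
  proof -
    have "{h \<in> edges H. f v \<in> ends H h} = g ` {h \<in> edges G. v \<in> ends G h}"
      using g e wf_ends_subset[OF wf] f(1) v by (auto simp: inj_on_image_mem_iff)
    then show ?thesis
      unfolding degree_def using g(1) by (simp add: card_image inj_on_def)
  qed
  have "V2 H = f ` V2 G" unfolding V2_def using f deg by auto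
  moreover have "V2 G \<subseteq> verts G" unfolding V2_def by blast
  ultimately show "card (V2 H) = card (V2 G)" using f(1) by (simp add: card_image inj_on_subset)
qed

lemma extremal_isomorphic:
  assumes G: "G \<in> H4 \<inter> H3" and iso: "isomorphic G H"
  shows "H \<in> H4 \<inter> H3"
proof -
  have G': "bipartite G" "minimal_matching_covered G" "two_vertex_n_extremal G" "edge_extremal G"
    using G unfolding H3_def H4_def by auto
  then have wf: "wf_multigraph G" unfolding minimal_matching_covered_def matching_covered_def by blast
  note c = card_isomorphic[OF wf iso]
  show ?thesis
    using bipartite_isomorphic[OF G'(1) iso] minimal_matching_covered_isomorphic[OF G'(2) iso] G'(3,4)
    unfolding H3_def H4_def by (auto simp: c two_vertex_n_extremal_def edge_extremal_def)
qed

section \<open>The graph Theta\<close>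

lemma perfect_matchingI:
  assumes "M \<subseteq> edges G" "\<And>v. v \<in> verts G \<Longrightarrow> \<exists>e\<in>M. v \<in> ends G e"
    "\<And>e f. e \<in> M \<Longrightarrow> f \<in> M \<Longrightarrow> e \<noteq> f \<Longrightarrow> ends G e \<inter> ends G f = {}"
  shows "perfect_matching G M"
  unfolding perfect_matching_def
proof (intro conjI ballI assms(1))
  fix v assume "v \<in> verts G"
  then obtain e where e: "e \<in> M" "v \<in> ends G e" using assms(2) by blast
  show "\<exists>!e. e \<in> M \<and> v \<in> ends G e"
  proof (rule ex1I[of _ e])
    fix f assume "f \<in> M \<and> v \<in> ends G f"
    then show "f = e" using e assms(3)[of f e] by blast
  qed (use e in blast)
qed

text \<open>A pendant edge lies in every perfect matching, so edges adjacent to it lie in none.\<close>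

lemma pendant_edge_not_matching_covered:
  assumes "e \<in> edges G" "ends G e = {v, u}" "v \<in> verts G" "u \<in> verts G"
    and "e' \<in> edges G" "u \<in> ends G e'" "e' \<noteq> e"
    and "\<And>h. h \<in> edges G \<Longrightarrow> v \<in> ends G h \<Longrightarrow> h = e"
  shows "\<not> matching_covered G"
proof
  assume "matching_covered G"
  then obtain M where M: "perfect_matching G M" "e' \<in> M"
    using assms(5) unfolding matching_covered_def by blast
  obtain h where h: "h \<in> M" "v \<in> ends G h" using M(1) assms(3) unfolding perfect_matching_def by blast
  have "h = e" using h M(1) assms(8) unfolding perfect_matching_def by blast
  then have "e' = e" using perfect_matching_unique[OF M(1) assms(4) M(2), of e] h assms(2,6) by auto
  with assms(7) show False by blast
qed

lemma Theta_simps: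
  "verts Theta = {0, 1, 2, 3, 4, 5, 6, 7}"
  "edges Theta = {{0, 1}, {1, 2}, {2, 7}, {0, 3}, {3, 4}, {4, 7}, {0, 5}, {5, 6}, {6, 7}}"
  "ends Theta e = e"
  unfolding Theta_def by auto

lemma Theta_wf: "wf_multigraph Theta"
  unfolding wf_multigraph_def Theta_simps by auto

lemma Theta_matching_covered: "matching_covered Theta"
proof -
  have adj: "(a, b) \<in> adjacency Theta \<longleftrightarrow> {a, b} \<in> edges Theta" for a b
    unfolding adjacency_def Theta_simps(3) by blast
  let ?J = "(adjacency Theta)\<^sup>*"
  have sym: "sym ?J"
    by (intro sym_rtrancl symI) (simp add: adj insert_commute)
  have 1: "(0, 1) \<in> ?J" "(0, 3) \<in> ?J" "(0, 5) \<in> ?J"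
    by (intro r_into_rtrancl; simp add: adj Theta_simps)+
  have 2: "(0, 2) \<in> ?J" "(0, 4) \<in> ?J" "(0, 6) \<in> ?J"
    by (intro rtrancl_into_rtrancl[OF 1(1)] rtrancl_into_rtrancl[OF 1(2)]
      rtrancl_into_rtrancl[OF 1(3)]; simp add: adj Theta_simps)+
  have 3: "(0, 7) \<in> ?J"
    by (intro rtrancl_into_rtrancl[OF 2(1)]) (simp add: adj Theta_simps)
  have root: "(0, v) \<in> ?J" if "v \<in> verts Theta" for v
    using that 1 2 3 unfolding Theta_simps by auto
  have "connected_graph Theta"
    unfolding connected_graph_def
  proof (intro conjI ballI)
    fix u v assume "u \<in> verts Theta" "v \<in> verts Theta"
    then show "(u, v) \<in> ?J" using root symD[OF sym] by (meson rtrancl_trans)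
  qed (simp add: Theta_simps)
  \<comment> \<open>In each matching one path contributes its two outer edges and the others their
    middle edges. Together the three matchings cover all nine edges.\<close>
  moreover have "perfect_matching Theta {{0, 1}, {2, 7}, {3, 4}, {5, 6}}"
    "perfect_matching Theta {{0, 3}, {4, 7}, {1, 2}, {5, 6}}"
    "perfect_matching Theta {{0, 5}, {6, 7}, {1, 2}, {3, 4}}"
    by (rule perfect_matchingI; unfold Theta_simps; auto)+
  then have "\<exists>M. perfect_matching Theta M \<and> e \<in> M" if "e \<in> edges Theta" for e
    using that unfolding Theta_simps(2) by (elim insertE emptyE) blast+
  moreover have "4 \<le> card (verts Theta)" by (simp add: Theta_simps)
  ultimately show ?thesis using Theta_wf unfolding matching_covered_def by blast
qed

text \<open>Every edge has an end of degree two. Deleting the edge makes this end pendant, and its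
  remaining neighbour still has another edge.\<close>

lemma Theta_minimal: "minimal_matching_covered Theta"
  unfolding minimal_matching_covered_def
proof (intro conjI ballI Theta_matching_covered)
  fix e assume e: "e \<in> edges Theta"
  have H: "edges (delete_edge Theta e) = edges Theta - {e}"
    "verts (delete_edge Theta e) = verts Theta" "ends (delete_edge Theta e) h = h" for h
    unfolding delete_edge_def by (simp_all add: Theta_simps(3))
  have pendant: "\<not> matching_covered (delete_edge Theta e)"
    if "{v, u} \<in> edges Theta - {e}" "v \<in> verts Theta" "u \<in> verts Theta"
      "{u, w} \<in> edges Theta - {e}" "v \<noteq> w" "\<forall>h\<in>edges Theta - {e}. v \<in> h \<longrightarrow> h = {v, u}" for v u w
  proof (rule pendant_edge_not_matching_covered[of "{v, u}" _ v u "{u, w}"]; (unfold H)?)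
    show "{u, w} \<noteq> {v, u}" using that(5) by (simp add: doubleton_eq_iff)
  qed (use that in blast)+
  show "\<not> matching_covered (delete_edge Theta e)"
    using e unfolding Theta_simps(2)
  proof (elim insertE emptyE)
    assume "e = {0, 1}"
    then show ?thesis by (intro pendant[of 1 2 7]) (auto simp: Theta_simps doubleton_eq_iff)
  next
    assume "e = {1, 2}"
    then show ?thesis by (intro pendant[of 1 0 3]) (auto simp: Theta_simps doubleton_eq_iff)
  next
    assume "e = {2, 7}"
    then show ?thesis by (intro pendant[of 2 1 0]) (auto simp: Theta_simps doubleton_eq_iff)
  next
    assume "e = {0, 3}"
    then show ?thesis by (intro pendant[of 3 4 7]) (auto simp: Theta_simps doubleton_eq_iff)
  next
    assume "e = {3, 4}"
    then show ?thesis by (intro pendant[of 3 0 1]) (auto simp: Theta_simps doubleton_eq_iff)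
  next
    assume "e = {4, 7}"
    then show ?thesis by (intro pendant[of 4 3 0]) (auto simp: Theta_simps doubleton_eq_iff)
  next
    assume "e = {0, 5}"
    then show ?thesis by (intro pendant[of 5 6 7]) (auto simp: Theta_simps doubleton_eq_iff)
  next
    assume "e = {5, 6}"
    then show ?thesis by (intro pendant[of 5 0 1]) (auto simp: Theta_simps doubleton_eq_iff)
  next
    assume "e = {6, 7}"
    then show ?thesis by (intro pendant[of 6 5 0]) (auto simp: Theta_simps doubleton_eq_iff)
  qed
qed

lemma Theta_extremal: "Theta \<in> H4 \<inter> H3"
proof -
  have "bipartite Theta"
    unfolding bipartite_def Theta_simps
    by (intro exI[of _ "{0, 2, 4, 6}"] exI[of _ "{1, 3, 5, 7}"]) (auto simp: doubleton_eq_iff)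
  moreover have "edge_extremal Theta"
    unfolding edge_extremal_def Theta_simps by (simp add: doubleton_eq_iff)
  moreover have "two_vertex_n_extremal Theta"
  proof -
    \<comment> \<open>As a sum over the nine explicit edges, the degree can be evaluated by
      simplification.\<close>
    have deg: "degree Theta v = (\<Sum>e\<in>edges Theta. if v \<in> e then 1 else 0)" for v
      unfolding degree_def Theta_simps(3) by (simp add: Theta_simps(2) flip: sum.inter_filter)
    have "degree Theta 0 = 3" "degree Theta 7 = 3" "degree Theta 1 = 2" "degree Theta 2 = 2"
      "degree Theta 3 = 2" "degree Theta 4 = 2" "degree Theta 5 = 2" "degree Theta 6 = 2"
      unfolding deg Theta_simps by (simp_all add: doubleton_eq_iff)
    then have "V2 Theta = {1, 2, 3, 4, 5, 6}"
      unfolding V2_def Theta_simps by auto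
    then show ?thesis unfolding two_vertex_n_extremal_def Theta_simps by simp
  qed
  ultimately show ?thesis using Theta_minimal unfolding H3_def H4_def by blast
qed

section \<open>Edge extremal graphs\<close>

lemma card_adj_pairs:
  assumes G: "bipartition G A B" and inj: "inj_on (ends G) (edges G)"
  shows "card (adj_pairs G A B) = card (edges G)"
proof -
  let ?p = "\<lambda>(a, b). {a, b}"
  have "inj_on ?p (adj_pairs G A B)"
    using bipartition_pair_eq[OF G] unfolding adj_pairs_def inj_on_def by auto
  moreover have "?p ` adj_pairs G A B = ends G ` edges G"
    using G unfolding bipartition_def adj_pairs_def by (fastforce simp: image_iff)
  ultimately show ?thesis using inj by (metis card_image)
qed

lemma degree_adj_pairs:
  assumes G: "bipartition G A B" and inj: "inj_on (ends G) (edges G)"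
  shows "a \<in> A \<Longrightarrow> degree G a = card {b. (a, b) \<in> adj_pairs G A B}"
    and "b \<in> B \<Longrightarrow> degree G b = card {a. (a, b) \<in> adj_pairs G A B}"
proof -
  have dis: "A \<inter> B = {}" using G unfolding bipartition_def by blast
  have ex: "\<exists>a\<in>A. \<exists>b\<in>B. ends G e = {a, b}" if "e \<in> edges G" for e
    using G that unfolding bipartition_def by blast
  have deg: "degree G v = card (ends G ` {e \<in> edges G. v \<in> ends G e})" for v
    unfolding degree_def using inj by (subst card_image) (auto intro: inj_on_subset)
  show "degree G a = card {b. (a, b) \<in> adj_pairs G A B}" if a: "a \<in> A"
  proof -
    have "ends G ` {e \<in> edges G. a \<in> ends G e} = (\<lambda>b. {a, b}) ` {b. (a, b) \<in> adj_pairs G A B}"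
    proof (intro equalityI subsetI)
      fix S assume "S \<in> ends G ` {e \<in> edges G. a \<in> ends G e}"
      then obtain e where e: "e \<in> edges G" "a \<in> ends G e" "S = ends G e" by blast
      then obtain a' b where ab: "a' \<in> A" "b \<in> B" "ends G e = {a', b}" using ex by blast
      have "a' = a" using a dis e(2) ab by auto
      with e ab have "(a, b) \<in> adj_pairs G A B" "S = {a, b}" unfolding adj_pairs_def by auto
      then show "S \<in> (\<lambda>b. {a, b}) ` {b. (a, b) \<in> adj_pairs G A B}" by blast
    next
      fix S assume "S \<in> (\<lambda>b. {a, b}) ` {b. (a, b) \<in> adj_pairs G A B}"
      then obtain b e where "S = {a, b}" "e \<in> edges G" "ends G e = {a, b}"
        unfolding adj_pairs_def by blast
      then show "S \<in> ends G ` {e \<in> edges G. a \<in> ends G e}" by blast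
    qed
    moreover have "inj_on (\<lambda>b. {a, b}) X" for X by (auto simp: inj_on_def doubleton_eq_iff)
    ultimately show ?thesis unfolding deg by (simp add: card_image)
  qed
  show "degree G b = card {a. (a, b) \<in> adj_pairs G A B}" if b: "b \<in> B"
  proof -
    have "ends G ` {e \<in> edges G. b \<in> ends G e} = (\<lambda>a. {a, b}) ` {a. (a, b) \<in> adj_pairs G A B}"
    proof (intro equalityI subsetI)
      fix S assume "S \<in> ends G ` {e \<in> edges G. b \<in> ends G e}"
      then obtain e where e: "e \<in> edges G" "b \<in> ends G e" "S = ends G e" by blast
      then obtain a b' where ab: "a \<in> A" "b' \<in> B" "ends G e = {a, b'}" using ex by blast
      have "b' = b" using b dis e(2) ab by auto
      with e ab have "(a, b) \<in> adj_pairs G A B" "S = {a, b}" unfolding adj_pairs_def by auto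
      then show "S \<in> (\<lambda>a. {a, b}) ` {a. (a, b) \<in> adj_pairs G A B}" by blast
    next
      fix S assume "S \<in> (\<lambda>a. {a, b}) ` {a. (a, b) \<in> adj_pairs G A B}"
      then obtain a e where "S = {a, b}" "e \<in> edges G" "ends G e = {a, b}"
        unfolding adj_pairs_def by blast
      then show "S \<in> ends G ` {e \<in> edges G. b \<in> ends G e}" by blast
    qed
    moreover have "inj_on (\<lambda>a. {a, b}) X" for X by (auto simp: inj_on_def doubleton_eq_iff)
    ultimately show ?thesis unfolding deg by (simp add: card_image)
  qed
qed

text \<open>With N = \<open>card A\<close> there are 3N - 3 edges, N of them in the matching, which
  leaves 2N - 3 arcs. Undoing the contraction, \<open>s\<close> and \<open>\<mu> t\<close> are
  joined by the path \<open>s\<close>, \<open>\<mu> s\<close>, \<open>t\<close>,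
  \<open>\<mu> t\<close> and by the paths \<open>s\<close>, \<open>\<mu> w\<close>,
  \<open>w\<close>, \<open>\<mu> t\<close> for \<open>w\<close> in \<open>W\<close>.\<close>

lemma edge_extremal_theta_structure:
  assumes G: "bipartition G A B" and min: "minimal_matching_covered G" and ee: "edge_extremal G"
  obtains \<mu> s t W where "bij_betw \<mu> A B" "A = insert s (insert t W)" "s \<noteq> t" "s \<notin> W" "t \<notin> W"
    "W \<noteq> {}" "\<And>a b. a \<in> A \<Longrightarrow> b \<in> A \<Longrightarrow> (a, \<mu> b) \<in> adj_pairs G A B \<longleftrightarrow>
      a = b \<or> a = t \<and> b = s \<or> a = s \<and> b \<in> W \<or> a \<in> W \<and> b = t"
proof -
  let ?E = "adj_pairs G A B"
  have mc: "matching_covered G" using min unfolding minimal_matching_covered_def by blast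
  have fin: "finite A" "finite B" using finite_bipartition[OF G] by auto
  have AB: "verts G = A \<union> B" "A \<inter> B = {}" using G unfolding bipartition_def by auto
  have n: "4 \<le> card (verts G)" using mc unfolding matching_covered_def by blast
  have "card (edges G) > 0"
    using ee n unfolding edge_extremal_def by (cases "card (edges G)") auto
  then obtain e where "e \<in> edges G" by (metis card.empty ex_in_conv less_numeral_extra(3))
  then obtain M where "perfect_matching G M" using mc unfolding matching_covered_def by blast
  then obtain \<mu> where \<mu>: "matching_map A B ?E \<mu>"
    using matching_map_of_perfect_matching[OF G] by metis
  then have b: "bij_betw \<mu> A B" and \<mu>AB: "\<mu> ` A = B" "inj_on \<mu> A"
    unfolding matching_map_def bij_betw_def by auto
  have inj: "inj_on (ends G) (edges G)" using min by (rule minimal_matching_covered_simple)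
  let ?R = "matching_digraph A ?E \<mu>"
  have RA: "?R \<subseteq> A \<times> A" unfolding matching_digraph_def by blast
  then have finR: "finite ?R" using fin finite_subset by blast
  \<comment> \<open>The diagonal stands for the matching edges, \<open>?R\<close> for all
    others.\<close>
  have "?E = (\<lambda>(a, b). (a, \<mu> b)) ` (?R \<union> Id_on A)"
  proof -
    have "p \<in> (\<lambda>(a, b). (a, \<mu> b)) ` (?R \<union> Id_on A)" if p: "p \<in> ?E" for p
    proof -
      obtain a b where ab: "p = (a, \<mu> b)" "a \<in> A" "b \<in> A"
        using p \<mu>AB(1) unfolding adj_pairs_def by auto
      then have "(a, b) \<in> ?R \<union> Id_on A" using p unfolding matching_digraph_def by auto
      then show ?thesis using ab(1) by force
    qed
    moreover have "?E \<supseteq> (\<lambda>(a, b). (a, \<mu> b)) ` (?R \<union> Id_on A)"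
      using \<mu> unfolding matching_digraph_def matching_map_def by auto
    ultimately show ?thesis by blast
  qed
  moreover have "inj_on (\<lambda>(a, b). (a, \<mu> b)) (A \<times> A)"
    using \<mu>AB(2) unfolding inj_on_def by auto
  then have "inj_on (\<lambda>(a, b). (a, \<mu> b)) (?R \<union> Id_on A)"
    by (rule inj_on_subset) (use RA in auto)
  ultimately have "card ?E = card (?R \<union> Id_on A)" by (metis card_image)
  also have "\<dots> = card ?R + card (Id_on A)"
    using fin finR by (intro card_Un_disjoint) (auto simp: matching_digraph_def Id_on_def)
  also have "card (Id_on A) = card A"
  proof -
    have "Id_on A = (\<lambda>a. (a, a)) ` A" by auto
    then show ?thesis by (simp add: card_image inj_on_def)
  qed
  finally have cE: "card (edges G) = card ?R + card A" using card_adj_pairs[OF G inj] by simp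
  have "card B = card A" using b bij_betw_same_card by metis
  then have cV: "card (verts G) = 2 * card A" using AB fin by (simp add: card_Un_disjoint)
  have cR: "card ?R + 3 = 2 * card A"
    using ee n unfolding edge_extremal_def cE cV by (simp add: field_simps)
  have mm: "strong A (matching_digraph A ?E \<nu>) \<and> irredundant (matching_digraph A ?E \<nu>)"
    if "matching_map A B ?E \<nu>" for \<nu>
    using matching_covered_imp_strong[OF G mc that] minimal_matching_covered_irredundant[OF G min that]
    by blast
  have no2: "(y, x) \<notin> ?R" if xy: "(x, y) \<in> ?R" for x y
  proof
    assume yx: "(y, x) \<in> ?R"
    have ne: "x \<noteq> y" using xy unfolding matching_digraph_def by blast
    then have "card {(x, y), (y, x)} = 2" by simp
    then have "2 \<le> card ?R" using xy yx finR by (metis card_mono empty_subsetI insert_subset)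
    \<comment> \<open>Two arcs give 2N - 3 >= 2, hence N >= 3 and a third vertex.\<close>
    then have "card {x, y} < card A" using cR ne by simp
    then obtain z where "z \<in> A" "z \<notin> {x, y}"
      by (metis card_mono finite.emptyI finite.insertI not_less subsetI)
    then show False
      using irredundant_matching_digraph_no_2_cycle[OF mm \<mu> xy yx] by blast
  qed
  interpret extremal_digraph A ?R
    by unfold_locales (use fin RA mm[OF \<mu>] no2 cR in auto)
  obtain s t W where W: "A = insert s (insert t W)" "s \<noteq> t" "s \<notin> W" "t \<notin> W" "W \<noteq> {}"
    and R: "?R = insert (t, s) (\<Union>w\<in>W. {(s, w), (w, t)})"
    by (rule theta_structure)
  have "(a, \<mu> b) \<in> ?E \<longleftrightarrow> a = b \<or> a = t \<and> b = s \<or> a = s \<and> b \<in> W \<or> a \<in> W \<and> b = t"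
    if "a \<in> A" "b \<in> A" for a b
  proof -
    have "(a, \<mu> b) \<in> ?E \<longleftrightarrow> a = b \<or> (a, b) \<in> ?R"
      using that \<mu> unfolding matching_digraph_def matching_map_def by auto
    also have "(a, b) \<in> ?R \<longleftrightarrow> a = t \<and> b = s \<or> a = s \<and> b \<in> W \<or> a \<in> W \<and> b = t"
      unfolding R by auto
    finally show ?thesis .
  qed
  with b W show thesis using that by blast
qed

text \<open>Only \<open>s\<close> and \<open>\<mu> t\<close> can have a degree other than two,
  namely \<open>card W + 1\<close>. Counting \<open>V2\<close> therefore determines
  \<open>card W\<close>, and with it the number \<open>card W + 1\<close> of paths.\<close>

lemma extremal_imp_isomorphic_Theta:
  assumes GH: "G \<in> H4 \<inter> H3"
  shows "wf_multigraph G \<and> isomorphic G Theta"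
proof -
  have bip: "bipartite G" and min: "minimal_matching_covered G" and ee: "edge_extremal G"
    and te: "two_vertex_n_extremal G"
    using GH unfolding H3_def H4_def by auto
  have wf: "wf_multigraph G" using min unfolding minimal_matching_covered_def matching_covered_def by blast
  obtain A B where G: "bipartition G A B"
    using bip wf unfolding bipartite_def bipartition_def by blast
  let ?E = "adj_pairs G A B"
  obtain \<mu> s t W where b: "bij_betw \<mu> A B" and W: "A = insert s (insert t W)" "s \<noteq> t" "s \<notin> W" "t \<notin> W" "W \<noteq> {}"
    and E: "\<And>a b. a \<in> A \<Longrightarrow> b \<in> A \<Longrightarrow> (a, \<mu> b) \<in> ?E \<longleftrightarrow>
      a = b \<or> a = t \<and> b = s \<or> a = s \<and> b \<in> W \<or> a \<in> W \<and> b = t"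
    by (rule edge_extremal_theta_structure[OF G min ee]) blast
  have \<mu>AB: "\<mu> ` A = B" "inj_on \<mu> A" using b unfolding bij_betw_def by auto
  have AB: "verts G = A \<union> B" "A \<inter> B = {}" using G unfolding bipartition_def by auto
  have fin: "finite A" "finite B" using finite_bipartition[OF G] by auto
  have inj: "inj_on (ends G) (edges G)" using min by (rule minimal_matching_covered_simple)
  have degA: "degree G a = card {b \<in> A. (a, \<mu> b) \<in> ?E}" if "a \<in> A" for a
  proof -
    have "{b. (a, b) \<in> ?E} = \<mu> ` {b \<in> A. (a, \<mu> b) \<in> ?E}"
      using \<mu>AB(1) unfolding adj_pairs_def by auto
    moreover have "inj_on \<mu> {b \<in> A. (a, \<mu> b) \<in> ?E}" using \<mu>AB(2) by (rule inj_on_subset) blast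
    ultimately show ?thesis using degree_adj_pairs(1)[OF G inj that] by (simp add: card_image)
  qed
  have degB: "degree G (\<mu> b) = card {a \<in> A. (a, \<mu> b) \<in> ?E}" if "b \<in> A" for b
  proof -
    have "{a. (a, \<mu> b) \<in> ?E} = {a \<in> A. (a, \<mu> b) \<in> ?E}" unfolding adj_pairs_def by blast
    then show ?thesis using degree_adj_pairs(2)[OF G inj, of "\<mu> b"] \<mu>AB(1) that by auto
  qed
  have finW: "finite W" using fin(1) W(1) by simp
  have cA: "card A = card W + 2" using W finW by simp
  have stA: "s \<in> A" "t \<in> A" using W by auto
  have "{b \<in> A. (s, \<mu> b) \<in> ?E} = insert s W" "{b \<in> A. (t, \<mu> b) \<in> ?E} = {t, s}"
    "{a \<in> A. (a, \<mu> s) \<in> ?E} = {s, t}" "{a \<in> A. (a, \<mu> t) \<in> ?E} = insert t W"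
    using E W by auto
  then have deg: "degree G s = card W + 1" "degree G t = 2"
    "degree G (\<mu> s) = 2" "degree G (\<mu> t) = card W + 1"
    using degA[OF stA(1)] degA[OF stA(2)] degB[OF stA(1)] degB[OF stA(2)] W finW by auto
  have degW: "degree G w = 2" "degree G (\<mu> w) = 2" if w: "w \<in> W" for w
  proof -
    have "{b \<in> A. (w, \<mu> b) \<in> ?E} = {w, t}" "{a \<in> A. (a, \<mu> w) \<in> ?E} = {w, s}"
      using E W w by auto
    moreover have "w \<noteq> t" "w \<noteq> s" "w \<in> A" using w W by auto
    ultimately show "degree G w = 2" "degree G (\<mu> w) = 2" using degA[of w] degB[of w] by auto
  qed
  have V: "verts G = {s, t, \<mu> s, \<mu> t} \<union> W \<union> \<mu> ` W" using AB(1) \<mu>AB(1) W(1) by auto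
  have "card B = card A" using b bij_betw_same_card by metis
  then have cV: "card (verts G) = 2 * card A" using AB fin by (simp add: card_Un_disjoint)
  have "card W > 0" using W finW by (simp add: card_gt_0_iff)
  \<comment> \<open>This is the 6-cycle: six vertices of degree two, where extremality asks for
    five.\<close>
  moreover have "card W \<noteq> 1"
  proof
    assume "card W = 1"
    then have "V2 G = verts G" unfolding V2_def using V deg degW by auto
    then show False using te cV cA \<open>card W = 1\<close> unfolding two_vertex_n_extremal_def by simp
  qed
  ultimately have W2: "card W \<ge> 2" by linarith
  have "s \<noteq> \<mu> t" using AB(2) \<mu>AB(1) stA by blast
  have "V2 G = verts G - {s, \<mu> t}"
    unfolding V2_def using deg degW W2 V by auto
  then have "card (V2 G) = 2 * card A - 2"
    using \<open>s \<noteq> \<mu> t\<close> stA AB(1) \<mu>AB(1) cV wf unfolding wf_multigraph_def by (auto simp: card_Diff_subset)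
  \<comment> \<open>With N = \<open>card W + 2\<close>, the equation 2N - 2 = N + 2 gives N =
    4.\<close>
  then have "card W = 2" using te cV cA unfolding two_vertex_n_extremal_def by simp
  then obtain x y where xy: "W = {x, y}" "x \<noteq> y" by (auto simp: card_2_iff)
  have A: "A = {s, t, x, y}" and dA: "s \<noteq> t" "s \<noteq> x" "s \<noteq> y" "t \<noteq> x" "t \<noteq> y" "x \<noteq> y"
    using W xy by auto
  have V: "verts G = {s, \<mu> s, t, \<mu> x, x, \<mu> y, y, \<mu> t}" using V xy by auto
  have d\<mu>: "\<mu> s \<noteq> \<mu> t" "\<mu> s \<noteq> \<mu> x" "\<mu> s \<noteq> \<mu> y" "\<mu> t \<noteq> \<mu> x" "\<mu> t \<noteq> \<mu> y" "\<mu> x \<noteq> \<mu> y"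
    using dA inj_on_eq_iff[OF \<mu>AB(2)] A by auto
  have dAB: "a \<noteq> \<mu> b" if "a \<in> A" "b \<in> A" for a b using that AB(2) \<mu>AB(1) by blast
  \<comment> \<open>Labels follow the three paths from \<open>s\<close> to \<open>\<mu> t\<close>,
    through \<open>\<mu> s\<close>, \<open>t\<close>, then \<open>\<mu> x\<close>, \<open>x\<close>,
    then \<open>\<mu> y\<close>, \<open>y\<close>. The default 7 is the label of
    \<open>\<mu> t\<close>.\<close>
  define f where "f v = (if v = s then 0 else if v = \<mu> s then 1 else if v = t then 2
    else if v = \<mu> x then 3 else if v = x then 4 else if v = \<mu> y then 5 else if v = y then 6 else 7 :: nat)" for v
  have fv: "f s = 0" "f (\<mu> s) = 1" "f t = 2" "f (\<mu> x) = 3" "f x = 4" "f (\<mu> y) = 5" "f y = 6" "f (\<mu> t) = 7"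
    unfolding f_def using dA d\<mu> dAB dAB[symmetric] by (auto simp: A)
  have fV: "f ` verts G = verts Theta" unfolding V Theta_simps by (simp add: fv)
  have finj: "inj_on f (verts G)" unfolding V by (auto simp: inj_on_def fv)
  have "ends G ` edges G = (\<lambda>(a, b). {a, \<mu> b}) ` {(a, b). a \<in> A \<and> b \<in> A \<and> (a, \<mu> b) \<in> ?E}"
  proof -
    have "ends G ` edges G = (\<lambda>(a, b). {a, b}) ` ?E"
      using G unfolding bipartition_def adj_pairs_def by (fastforce simp: image_iff)
    also have "?E = (\<lambda>(a, b). (a, \<mu> b)) ` {(a, b). a \<in> A \<and> b \<in> A \<and> (a, \<mu> b) \<in> ?E}"
    proof -
      have "a \<in> A \<and> b \<in> \<mu> ` A" if "(a, b) \<in> ?E" for a b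
        using that \<mu>AB(1) unfolding adj_pairs_def by auto
      then show ?thesis by (fastforce simp: image_iff)
    qed
    finally show ?thesis by (simp add: image_image case_prod_unfold)
  qed
  also have "{(a, b). a \<in> A \<and> b \<in> A \<and> (a, \<mu> b) \<in> ?E} =
    {(s, s), (t, s), (t, t), (s, x), (x, x), (x, t), (s, y), (y, y), (y, t)}"
  proof -
    have "{(a, b). a \<in> A \<and> b \<in> A \<and> (a, \<mu> b) \<in> ?E} = {(a, b). a \<in> A \<and> b \<in> A \<and>
      (a = b \<or> a = t \<and> b = s \<or> a = s \<and> b \<in> W \<or> a \<in> W \<and> b = t)}"
      using E by blast
    then show ?thesis unfolding A xy(1) by auto
  qed
  finally have ends: "ends G ` edges G = {{s, \<mu> s}, {t, \<mu> s}, {t, \<mu> t}, {s, \<mu> x}, {x, \<mu> x}, {x, \<mu> t},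
    {s, \<mu> y}, {y, \<mu> y}, {y, \<mu> t}}"
    by simp
  \<comment> \<open>Edges of \<open>Theta\<close> are their own sets of ends, so \<open>f\<close>
    dictates the edge map.\<close>
  let ?g = "\<lambda>e. f ` ends G e"
  have "?g ` edges G = (`) f ` (ends G ` edges G)" by (simp add: image_image)
  also have "\<dots> = edges Theta" unfolding ends Theta_simps by (simp add: fv insert_commute)
  finally have gE: "?g ` edges G = edges Theta" .
  have ginj: "inj_on ?g (edges G)"
  proof (rule inj_onI)
    fix e e' assume e: "e \<in> edges G" "e' \<in> edges G" "?g e = ?g e'"
    then have "ends G e = ends G e'"
      using inj_on_image_eq_iff[OF finj] wf_ends_subset[OF wf] by blast
    then show "e = e'" using inj e by (auto dest: inj_onD)
  qed
  have "isomorphic G Theta"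
    unfolding isomorphic_def bij_betw_def using fV finj gE ginj
    by (intro exI[of _ f] exI[of _ ?g]) (simp add: Theta_simps(3))
  with wf show ?thesis by blast
qed

text \<open>\<open>isomorphic\<close> alone does not confine the ends of edges to the vertex set, so
  well-formedness is stated separately. If the types are too small to host a copy of
  \<open>Theta\<close>, both sides are empty.\<close>

theorem corollary7p5:
  "(H4 :: ('v, 'e) multigraph set) \<inter> H3 = {G. wf_multigraph G \<and> isomorphic G Theta}"
proof (intro equalityI subsetI)
  fix G :: "('v, 'e) multigraph" assume "G \<in> H4 \<inter> H3"
  then show "G \<in> {G. wf_multigraph G \<and> isomorphic G Theta}"
    using extremal_imp_isomorphic_Theta by blast
next
  fix G :: "('v, 'e) multigraph" assume "G \<in> {G. wf_multigraph G \<and> isomorphic G Theta}"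
  then show "G \<in> H4 \<inter> H3"
    using extremal_isomorphic[OF Theta_extremal] isomorphic_sym by blast
qed

end
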